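(* Let $S03$ be the bialgebra and $\tilde A,\tilde B,\tilde C,\tilde D$ the linear functionals on $S03$ defined in the context, and let $s03$ be the unital algebra they generate, with the bialgebra structure dual to that of $S03$. Then the following relations hold: $$[\tilde A,\tilde B]=[\tilde A,\tilde C]=0,\qquad \tilde A\tilde D=\tilde D\tilde A=\tilde D^3=\tilde B^2\tilde D=\tilde D\tilde B^2=\tilde D,\qquad [\tilde B,\tilde C]=-2\tilde D,$$ $$\tilde D\tilde B=-\tilde B\tilde D=\tilde C\tilde D^2=\tilde D^2\tilde C,\qquad \tilde C\tilde D+\tilde D\tilde C=0,\qquad \tilde B^2+\tilde C^2=0,$$ $$\tilde B^3=\tilde B,\qquad \tilde C^3=-\tilde C,\qquad \tilde B^2\tilde A=\tilde A;$$ the coproduct is $$\delta(\tilde A)=\tilde A\otimes 1+1\otimes\tilde A,\qquad \delta(\tilde B)=\tilde B\otimes 1+(1-\tilde B^2)\otimes\tilde B,$$ $$\delta(\tilde C)=\tilde C\otimes(1-\tilde B^2)+1\otimes\tilde C,\qquad \delta(\tilde D)=\tilde D\otimes(1-\tilde B^2)+(1-\tilde B^2)\otimes\tilde D,$$ and the counit is $\varepsilon(Z)=0$ for $Z=\tilde A,\tilde B,\tilde C,\tilde D$. The elements $\tilde A$, $\tilde B^2=-\tilde C^2$ and $\tilde D^2$ are Casimir operators (central in $s03$). The bialgebra $s03$ is not a Hopf algebra (it admits no antipode).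
   Context: $S03$ is the unital associative $\mathbb{C}$-algebra generated by $\tilde a,\tilde b,\tilde c,\tilde d$ with relations $\tilde b^2=\tilde c^2=0$, $\tilde a\tilde d=\tilde d\tilde a=0$, $\tilde a\tilde b=0$, $\tilde b\tilde d=0$, $\tilde d\tilde c=0$, $\tilde c\tilde a=0$. Its basis consists of the words in $\tilde a,\tilde b,\tilde c,\tilde d$ (including the empty word $1$) containing none of these forbidden adjacent pairs. It is a bialgebra with $\delta\tilde a=\tilde a\otimes\tilde a+\tilde b\otimes\tilde b-\tilde c\otimes\tilde c+\tilde d\otimes\tilde d$, $\delta\tilde b=\tilde a\otimes\tilde b+\tilde b\otimes\tilde a-\tilde c\otimes\tilde d+\tilde d\otimes\tilde c$, $\delta\tilde c=\tilde a\otimes\tilde c+\tilde c\otimes\tilde a-\tilde b\otimes\tilde d+\tilde d\otimes\tilde b$, $\delta\tilde d=\tilde a\otimes\tilde d+\tilde d\otimes\tilde a-\tilde b\otimes\tilde c+\tilde c\otimes\tilde b$, $\varepsilon(\tilde a)=1$, $\varepsilon(\tilde b)=\varepsilon(\tilde c)=\varepsilon(\tilde d)=0$. The functionals are given on basis words $f$ (with $k\ge 0$) by: $\langle\tilde A,f\rangle=k$ if $f=\tilde a^k$, else $0$; $\langle\tilde B,f\rangle=1$ if $f=\tilde b\tilde a^k$, else $0$; $\langle\tilde C,f\rangle=1$ if $f=\tilde a^k\tilde c$, else $0$; $\langle\tilde D,f\rangle=1$ if $f=\tilde d$, else $0$. Duality: the product of functionals is $\langle uv,f\rangle=\langle u\otimes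 v,\delta(f)\rangle$, the unit $1$ of $s03$ is the counit $\varepsilon$ of $S03$, the coproduct on $s03$ is characterized by $\langle u,fg\rangle=\langle\delta(u),f\otimes g\rangle$ for all $f,g\in S03$, and the counit is $\varepsilon(u)=\langle u,1\rangle$. *)

theory Defs
  imports Complex_Main "HOL-Library.Poly_Mapping"
begin

section \<open>Complex vector spaces and algebras\<close>

class complex_vector = ab_group_add +
  fixes scaleC :: "complex \<Rightarrow> 'a \<Rightarrow> 'a"  (infixr \<open>*\<^sub>C\<close> 75)
  assumes scaleC_add_right: "c *\<^sub>C (x + y) = c *\<^sub>C x + c *\<^sub>C y"
    and scaleC_add_left: "(c + d) *\<^sub>C x = c *\<^sub>C x + d *\<^sub>C x"
    and scaleC_scaleC: "c *\<^sub>C d *\<^sub>C x = (c * d) *\<^sub>C x"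
    and scaleC_one: "1 *\<^sub>C x = x"

class complex_algebra = complex_vector + ring + monoid_mult +
  assumes mult_scaleC_left: "c *\<^sub>C x * y = c *\<^sub>C (x * y)"
    and mult_scaleC_right: "x * c *\<^sub>C y = c *\<^sub>C (x * y)"

global_interpretation cvec: vector_space "scaleC :: complex \<Rightarrow> 'a \<Rightarrow> 'a::complex_vector"
  by standard (simp_all add: scaleC_add_right scaleC_add_left scaleC_scaleC scaleC_one)

abbreviation clinear :: "('a::complex_vector \<Rightarrow> 'b::complex_vector) \<Rightarrow> bool"
  where "clinear \<equiv> Vector_Spaces.linear scaleC scaleC"

definition cbilinear ::
    "('a::complex_vector \<Rightarrow> 'b::complex_vector \<Rightarrow> 'c::complex_vector) \<Rightarrow> bool"
  where "cbilinear h \<longleftrightarrow> (\<forall>x. clinear (h x)) \<and> (\<forall>y. clinear (\<lambda>x. h x y))"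

definition algebra_hom :: "('a::complex_algebra \<Rightarrow> 'b::complex_algebra) \<Rightarrow> bool"
  where "algebra_hom f \<longleftrightarrow> clinear f \<and> f 1 = 1 \<and> (\<forall>x y. f (x * y) = f x * f y)"

instantiation complex :: complex_algebra
begin
definition scaleC_complex_def [simp]: "scaleC c (x::complex) = c * x"
instance by standard (simp_all add: algebra_simps)
end

lemma clinearI:
  assumes "\<And>x y. f (x + y) = f x + f y" and "\<And>c x. f (c *\<^sub>C x) = c *\<^sub>C f x"
  shows "clinear f"
  using assms by unfold_locales auto

lemma clinear_add: "clinear f \<Longrightarrow> f (x + y) = f x + f y"
  by (simp add: Vector_Spaces.linear_def module_hom_def module_hom_axioms_def)

lemma clinear_scale: "clinear f \<Longrightarrow> f (c *\<^sub>C x) = c *\<^sub>C f x"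
  by (simp add: Vector_Spaces.linear_def module_hom_def module_hom_axioms_def)

lemma clinear_0: "clinear f \<Longrightarrow> f 0 = 0"
  by (metis add_cancel_right_right clinear_add)

lemma clinear_diff: "clinear f \<Longrightarrow> f (x - y) = f x - f y"
  by (metis add_diff_cancel_right' clinear_add diff_add_cancel)

lemma clinear_sum: "clinear f \<Longrightarrow> f (sum g S) = (\<Sum>i\<in>S. f (g i))"
  by (induction S rule: infinite_finite_induct) (auto simp: clinear_0 clinear_add)

lemma clinear_compose:
  assumes "clinear f" "clinear g"
  shows "clinear (\<lambda>x. f (g x))"
  by (rule clinearI) (simp_all add: assms[THEN clinear_add] assms[THEN clinear_scale])

lemma clinear_zero_on_span:
  assumes "clinear f" "\<And>x. x \<in> S \<Longrightarrow> f x = 0" "x \<in> cvec.span S"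
  shows "f x = 0"
  using assms(3)
  by (induction rule: cvec.span_induct_alt)
     (simp_all add: clinear_0 clinear_add clinear_scale assms(1,2))

lemma cbilinearI:
  assumes "\<And>x x' y. h (x + x') y = h x y + h x' y" "\<And>c x y. h (c *\<^sub>C x) y = c *\<^sub>C h x y"
    and "\<And>x y y'. h x (y + y') = h x y + h x y'" "\<And>c x y. h x (c *\<^sub>C y) = c *\<^sub>C h x y"
  shows "cbilinear h"
  unfolding cbilinear_def using assms by (auto intro!: clinearI)

lemma cbilinearD:
  assumes "cbilinear h"
  shows "h (x + x') y = h x y + h x' y" "h (c *\<^sub>C x) y = c *\<^sub>C h x y"
    "h x (y + y') = h x y + h x y'" "h x (c *\<^sub>C y) = c *\<^sub>C h x y"
  using assms clinear_add[of "\<lambda>x. h x y"] clinear_scale[of "\<lambda>x. h x y"]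
  unfolding cbilinear_def by (auto simp: clinear_add clinear_scale)

instantiation poly_mapping :: (type, complex_vector) complex_vector
begin
lift_definition scaleC_poly_mapping :: "complex \<Rightarrow> ('a \<Rightarrow>\<^sub>0 'b) \<Rightarrow> 'a \<Rightarrow>\<^sub>0 'b"
  is "\<lambda>c p k. c *\<^sub>C p k"
  by (erule finite_subset[rotated]) auto
instance
  by standard (transfer; simp add: fun_eq_iff scaleC_add_right scaleC_add_left scaleC_scaleC scaleC_one)+
end

lemma lookup_scaleC [simp]: "Poly_Mapping.lookup (c *\<^sub>C p) k = c *\<^sub>C Poly_Mapping.lookup p k"
  by transfer simp

lemma scaleC_single [simp]: "c *\<^sub>C Poly_Mapping.single k a = Poly_Mapping.single k (c *\<^sub>C a)"
  by (rule poly_mapping_eqI) (simp add: lookup_single when_def)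

lemma scaleC_conv_mult:
  fixes p :: "'a::monoid_add \<Rightarrow>\<^sub>0 complex"
  shows "c *\<^sub>C p = Poly_Mapping.single 0 c * p"
  unfolding mult_map_scale_conv_mult[symmetric]
  by (rule poly_mapping_eqI) (simp add: Poly_Mapping.map.rep_eq when_def)

lemma poly_mapping_scaleC_left:
  fixes p q :: "'a::monoid_add \<Rightarrow>\<^sub>0 complex"
  shows "c *\<^sub>C p * q = c *\<^sub>C (p * q)"
  by (simp add: scaleC_conv_mult mult.assoc)

lemma poly_mapping_sum_single:
  "p = (\<Sum>k\<in>Poly_Mapping.keys p. Poly_Mapping.lookup p k *\<^sub>C Poly_Mapping.single k (1::complex))"
  by (rule poly_mapping_eqI)
     (simp add: lookup_sum lookup_single when_def in_keys_iff sum.delta)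

lemma poly_mapping_scaleC_right:
  fixes p q :: "'a::monoid_add \<Rightarrow>\<^sub>0 complex"
  shows "p * c *\<^sub>C q = c *\<^sub>C (p * q)"
proof -
  have *: "p * Poly_Mapping.single 0 c = Poly_Mapping.single 0 c * p"
  proof -
    have "p * Poly_Mapping.single 0 c = (\<Sum>k\<in>Poly_Mapping.keys p. Poly_Mapping.lookup p k *\<^sub>C Poly_Mapping.single k 1) * Poly_Mapping.single 0 c"
      using poly_mapping_sum_single[of p] by simp
    also have "\<dots> = Poly_Mapping.single 0 c * (\<Sum>k\<in>Poly_Mapping.keys p. Poly_Mapping.lookup p k *\<^sub>C Poly_Mapping.single k 1)"
      by (simp add: sum_distrib_left sum_distrib_right mult_single mult.commute)
    finally show ?thesis using poly_mapping_sum_single[of p] by simp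
  qed
  show ?thesis by (simp add: scaleC_conv_mult mult.assoc[symmetric] *)
qed

lemma poly_mapping_clinear_ext:
  fixes f g :: "('k \<Rightarrow>\<^sub>0 complex) \<Rightarrow> 'a::complex_vector"
  assumes "clinear f" "clinear g"
    and "\<And>k. f (Poly_Mapping.single k 1) = g (Poly_Mapping.single k 1)"
  shows "f p = g p"
proof -
  note [simp del] = scaleC_single
  have "f (\<Sum>k\<in>Poly_Mapping.keys p. Poly_Mapping.lookup p k *\<^sub>C Poly_Mapping.single k 1) =
        g (\<Sum>k\<in>Poly_Mapping.keys p. Poly_Mapping.lookup p k *\<^sub>C Poly_Mapping.single k 1)"
    by (simp add: clinear_sum clinear_scale assms)
  then show ?thesis using poly_mapping_sum_single[of p] by simp
qed

definition lin_ext :: "('k \<Rightarrow> 'a::complex_vector) \<Rightarrow> ('k \<Rightarrow>\<^sub>0 complex) \<Rightarrow> 'a"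
  where "lin_ext g p = (\<Sum>k\<in>Poly_Mapping.keys p. Poly_Mapping.lookup p k *\<^sub>C g k)"

lemma lin_ext_superset:
  assumes "finite S" "Poly_Mapping.keys p \<subseteq> S"
  shows "lin_ext g p = (\<Sum>k\<in>S. Poly_Mapping.lookup p k *\<^sub>C g k)"
  unfolding lin_ext_def using assms
  by (intro sum.mono_neutral_left) (auto simp: in_keys_iff)

lemma lin_ext_single [simp]: "lin_ext g (Poly_Mapping.single k c) = c *\<^sub>C g k"
  by (simp add: lin_ext_def)

lemma clinear_lin_ext: "clinear (lin_ext g)"
proof (rule clinearI)
  fix p q :: "'a \<Rightarrow>\<^sub>0 complex"
  let ?S = "Poly_Mapping.keys p \<union> Poly_Mapping.keys q"
  show "lin_ext g (p + q) = lin_ext g p + lin_ext g q"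
    using lin_ext_superset[of ?S p g] lin_ext_superset[of ?S q g]
      lin_ext_superset[of ?S "p + q" g] keys_add[of p q]
    by (simp add: lookup_add scaleC_add_left sum.distrib)
next
  fix c and p :: "'a \<Rightarrow>\<^sub>0 complex"
  show "lin_ext g (c *\<^sub>C p) = c *\<^sub>C lin_ext g p"
  proof -
    have "Poly_Mapping.keys (c *\<^sub>C p) \<subseteq> Poly_Mapping.keys p"
      by (auto simp: in_keys_iff)
    then show ?thesis
      using lin_ext_superset[of "Poly_Mapping.keys p" p g]
        lin_ext_superset[of "Poly_Mapping.keys p" "c *\<^sub>C p" g]
      by (simp add: cvec.scale_sum_right scaleC_scaleC)
  qed
qed


section \<open>Tensor products\<close>

text \<open>The algebraic tensor product over the complex numbers: the free vector space on pairs modulo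
  the span of the bilinearity relations. Multiplication on a tensor product of algebras is the
  unbraided one, \<open>(x \<otimes> y) * (x' \<otimes> y') = (x * x') \<otimes> (y * y')\<close>.\<close>

definition tensor_relators ::
    "(('a::complex_vector \<times> 'b::complex_vector) \<Rightarrow>\<^sub>0 complex) set" where
  "tensor_relators =
     {Poly_Mapping.single (x + x', y) 1 - Poly_Mapping.single (x, y) 1 - Poly_Mapping.single (x', y) 1 | x x' y. True} \<union>
     {Poly_Mapping.single (x, y + y') 1 - Poly_Mapping.single (x, y) 1 - Poly_Mapping.single (x, y') 1 | x y y'. True} \<union>
     {Poly_Mapping.single (c *\<^sub>C x, y) 1 - c *\<^sub>C Poly_Mapping.single (x, y) 1 | c x y. True} \<union>
     {Poly_Mapping.single (x, c *\<^sub>C y) 1 - c *\<^sub>C Poly_Mapping.single (x, y) 1 | c x y. True}"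

lemma equivp_span: "equivp (\<lambda>p q. p - q \<in> cvec.span S)"
proof (intro equivpI reflpI sympI transpI)
  show "x - x \<in> cvec.span S" for x by (simp add: cvec.span_zero)
  show "y - x \<in> cvec.span S" if "x - y \<in> cvec.span S" for x y
    using cvec.span_neg[OF that] by simp
  show "x - z \<in> cvec.span S" if "x - y \<in> cvec.span S" "y - z \<in> cvec.span S" for x y z
    using cvec.span_add[OF that] by simp
qed

quotient_type (overloaded) ('a, 'b) tensor =
    "('a::complex_vector \<times> 'b::complex_vector) \<Rightarrow>\<^sub>0 complex" /
    "\<lambda>p q. p - q \<in> cvec.span tensor_relators"
  by (rule equivp_span)

lemma span_congs:
  "p - p' \<in> cvec.span S \<Longrightarrow> q - q' \<in> cvec.span S \<Longrightarrow> (p + q) - (p' + q') \<in> cvec.span S"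
  "p - p' \<in> cvec.span S \<Longrightarrow> q - q' \<in> cvec.span S \<Longrightarrow> (p - q) - (p' - q') \<in> cvec.span S"
  "p - p' \<in> cvec.span S \<Longrightarrow> - p - (- p') \<in> cvec.span S"
  "p - p' \<in> cvec.span S \<Longrightarrow> c *\<^sub>C p - c *\<^sub>C p' \<in> cvec.span S"
proof -
  assume p: "p - p' \<in> cvec.span S"
  show "- p - (- p') \<in> cvec.span S" using cvec.span_neg[OF p] by simp
  show "c *\<^sub>C p - c *\<^sub>C p' \<in> cvec.span S"
    using cvec.span_scale[OF p, of c] by (simp add: cvec.scale_right_diff_distrib)
  assume q: "q - q' \<in> cvec.span S"
  show "(p + q) - (p' + q') \<in> cvec.span S"
    using cvec.span_add[OF p q] by (simp add: algebra_simps)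
  show "(p - q) - (p' - q') \<in> cvec.span S"
    using cvec.span_diff[OF p q] by (simp add: algebra_simps)
qed

instantiation tensor :: (complex_vector, complex_vector) complex_vector
begin
lift_definition zero_tensor :: "('a, 'b) tensor" is 0 .
lift_definition plus_tensor :: "('a, 'b) tensor \<Rightarrow> ('a, 'b) tensor \<Rightarrow> ('a, 'b) tensor" is "(+)"
  by (rule span_congs)
lift_definition minus_tensor :: "('a, 'b) tensor \<Rightarrow> ('a, 'b) tensor \<Rightarrow> ('a, 'b) tensor" is "(-)"
  by (rule span_congs)
lift_definition uminus_tensor :: "('a, 'b) tensor \<Rightarrow> ('a, 'b) tensor" is uminus
  by (rule span_congs)
lift_definition scaleC_tensor :: "complex \<Rightarrow> ('a, 'b) tensor \<Rightarrow> ('a, 'b) tensor" is scaleC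
  by (rule span_congs)
instance
  by standard (transfer; simp add: cvec.span_zero algebra_simps scaleC_add_right scaleC_add_left scaleC_scaleC scaleC_one)+
end

lift_definition pure_tensor :: "'a::complex_vector \<Rightarrow> 'b::complex_vector \<Rightarrow> ('a, 'b) tensor"
    (infixl \<open>\<otimes>\<close> 72)
  is "\<lambda>x y. Poly_Mapping.single (x, y) 1" .

text \<open>The linear map out of a tensor product that a bilinear map induces. It is only meaningful
  when the argument is bilinear.\<close>

definition tensor_lift ::
    "('a::complex_vector \<Rightarrow> 'b::complex_vector \<Rightarrow> 'c::complex_vector) \<Rightarrow> ('a, 'b) tensor \<Rightarrow> 'c"
  where "tensor_lift h = (THE f. clinear f \<and> (\<forall>x y. f (x \<otimes> y) = h x y))"

lemma abs_tensor_surj: "\<exists>p. t = abs_tensor p"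
  using Quotient3_abs_rep[OF Quotient3_tensor, of t] by metis

lemma clinear_abs_tensor: "clinear abs_tensor"
  by (rule clinearI) (simp_all add: plus_tensor.abs_eq scaleC_tensor.abs_eq)

lemma tensor_ext:
  fixes f g :: "('a::complex_vector, 'b::complex_vector) tensor \<Rightarrow> 'c::complex_vector"
  assumes "clinear f" "clinear g" "\<And>x y. f (x \<otimes> y) = g (x \<otimes> y)"
  shows "f t = g t"
proof -
  have "f (abs_tensor p) = g (abs_tensor p)" for p
  proof (rule poly_mapping_clinear_ext[where f = "\<lambda>p. f (abs_tensor p)" and g = "\<lambda>p. g (abs_tensor p)"])
    show "clinear (\<lambda>p. f (abs_tensor p))" "clinear (\<lambda>p. g (abs_tensor p))"
      using assms clinear_abs_tensor by (auto intro: clinear_compose)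
    show "f (abs_tensor (Poly_Mapping.single k 1)) = g (abs_tensor (Poly_Mapping.single k 1))" for k
      using assms(3)[of "fst k" "snd k"] by (simp add: pure_tensor.abs_eq)
  qed
  then show ?thesis using abs_tensor_surj[of t] by auto
qed

lemma cbilinear_pure_tensor: "cbilinear ((\<otimes>) :: 'a::complex_vector \<Rightarrow> 'b::complex_vector \<Rightarrow> _)"
proof (rule cbilinearI)
  fix x x' :: 'a and y y' :: 'b and c
  show "(x + x') \<otimes> y = x \<otimes> y + x' \<otimes> y"
    by (transfer, unfold diff_diff_eq[symmetric], rule cvec.span_base, unfold tensor_relators_def) blast
  show "x \<otimes> (y + y') = x \<otimes> y + x \<otimes> y'"
    by (transfer, unfold diff_diff_eq[symmetric], rule cvec.span_base, unfold tensor_relators_def) blast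
  show "c *\<^sub>C x \<otimes> y = c *\<^sub>C (x \<otimes> y)"
    by (transfer, rule cvec.span_base, unfold tensor_relators_def) blast
  show "x \<otimes> c *\<^sub>C y = c *\<^sub>C (x \<otimes> y)"
    by (transfer, rule cvec.span_base, unfold tensor_relators_def) blast
qed

lemmas pure_tensor_simps = cbilinearD[OF cbilinear_pure_tensor]

lemma tensor_lift_ex1:
  fixes h :: "'a::complex_vector \<Rightarrow> 'b::complex_vector \<Rightarrow> 'c::complex_vector"
  assumes "cbilinear h"
  shows "\<exists>!f. clinear f \<and> (\<forall>x y. f (x \<otimes> y) = h x y)"
proof -
  let ?e = "lin_ext (\<lambda>(x, y). h x y)"
  have z: "?e p = 0" if "p \<in> cvec.span tensor_relators" for p
  proof (rule clinear_zero_on_span[OF clinear_lin_ext _ that])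
    fix r :: "('a \<times> 'b) \<Rightarrow>\<^sub>0 complex"
    assume "r \<in> tensor_relators"
    then show "?e r = 0"
      unfolding tensor_relators_def
      by (elim UnE CollectE exE)
         (simp_all add: clinear_diff[OF clinear_lin_ext] cbilinearD[OF assms] scaleC_one)
  qed
  have abs: "?e (rep_tensor (abs_tensor p)) = ?e p" for p
  proof -
    have "rep_tensor (abs_tensor p) - p \<in> cvec.span tensor_relators"
      by (rule Quotient3_rep_abs[OF Quotient3_tensor]) (simp add: cvec.span_zero)
    from z[OF this] show ?thesis by (simp add: clinear_diff[OF clinear_lin_ext])
  qed
  define f where "f t = ?e (rep_tensor t)" for t
  have fabs: "f (abs_tensor p) = ?e p" for p by (simp add: f_def abs)
  have "clinear f"
  proof (rule clinearI)
    fix s t :: "('a, 'b) tensor" and c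
    obtain p q where "s = abs_tensor p" "t = abs_tensor q"
      using abs_tensor_surj by blast
    then show "f (s + t) = f s + f t" "f (c *\<^sub>C t) = c *\<^sub>C f t"
      by (simp_all add: plus_tensor.abs_eq scaleC_tensor.abs_eq fabs
          clinear_add[OF clinear_lin_ext] clinear_scale[OF clinear_lin_ext])
  qed
  moreover have "f (x \<otimes> y) = h x y" for x y
    by (simp add: pure_tensor.abs_eq fabs scaleC_one)
  ultimately show ?thesis
  proof (intro ex1I[of _ f] conjI allI ext)
    fix g t
    assume "clinear g \<and> (\<forall>x y. g (x \<otimes> y) = h x y)"
    with \<open>clinear f\<close> \<open>\<And>x y. f (x \<otimes> y) = h x y\<close> show "g t = f t"
      by - (rule tensor_ext; simp)
  qed
qed

lemma
  assumes "cbilinear h"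
  shows clinear_tensor_lift: "clinear (tensor_lift h)"
    and tensor_lift_pure: "tensor_lift h (x \<otimes> y) = h x y"
  using theI'[OF tensor_lift_ex1[OF assms]] unfolding tensor_lift_def by blast+

lemma tensor_lift_eqI:
  assumes "cbilinear h" "clinear f" "\<And>x y. f (x \<otimes> y) = h x y"
  shows "tensor_lift h t = f t"
  by (rule tensor_ext) (simp_all add: clinear_tensor_lift tensor_lift_pure assms)


lemma tensor_lift_cong_ext:
  assumes "cbilinear h" "cbilinear k" "clinear f" "\<And>x y. f (h x y) = k x y"
  shows "f (tensor_lift h t) = tensor_lift k t"
  by (rule tensor_ext[where f = "\<lambda>t. f (tensor_lift h t)"])
     (simp_all add: clinear_compose[OF assms(3)] assms(1,2)[THEN clinear_tensor_lift]
        assms(1,2)[THEN tensor_lift_pure] assms(4))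

lemma cbilinear_add:
  assumes "cbilinear h" "cbilinear k"
  shows "cbilinear (\<lambda>x y. h x y + k x y)"
  by (rule cbilinearI) (simp_all add: assms[THEN cbilinearD(1)] assms[THEN cbilinearD(2)]
      assms[THEN cbilinearD(3)] assms[THEN cbilinearD(4)] scaleC_add_right)

lemma cbilinear_scale:
  assumes "cbilinear h"
  shows "cbilinear (\<lambda>x y. c *\<^sub>C h x y)"
  by (rule cbilinearI) (simp_all add: cbilinearD[OF assms] scaleC_add_right scaleC_scaleC mult.commute)

lemma tensor_lift_add:
  assumes "cbilinear h" "cbilinear k"
  shows "tensor_lift (\<lambda>x y. h x y + k x y) t = tensor_lift h t + tensor_lift k t"
proof -
  note lin = assms[THEN clinear_tensor_lift]
  note lin = lin[THEN clinear_add] lin[THEN clinear_scale]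
  show ?thesis
    by (rule tensor_lift_eqI[OF cbilinear_add[OF assms]], rule clinearI)
       (simp_all add: assms[THEN tensor_lift_pure] lin scaleC_add_right)
qed

lemma tensor_lift_scale:
  assumes "cbilinear h"
  shows "tensor_lift (\<lambda>x y. c *\<^sub>C h x y) t = c *\<^sub>C tensor_lift h t"
proof -
  note lin = assms[THEN clinear_tensor_lift]
  note lin = lin[THEN clinear_add] lin[THEN clinear_scale]
  show ?thesis
    by (rule tensor_lift_eqI[OF cbilinear_scale[OF assms]], rule clinearI)
       (simp_all add: assms[THEN tensor_lift_pure] lin scaleC_add_right scaleC_scaleC mult.commute)
qed

lemma cbilinear_tensor_lift:
  assumes h: "\<And>x y. cbilinear (h x y)" and h': "\<And>x' y'. cbilinear (\<lambda>x y. h x y x' y')"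
  shows "cbilinear (\<lambda>x y. tensor_lift (h x y) t)"
proof (rule cbilinearI)
  fix x x1 y y1 c
  have "h (x + x1) y = (\<lambda>x' y'. h x y x' y' + h x1 y x' y')"
    "h x (y + y1) = (\<lambda>x' y'. h x y x' y' + h x y1 x' y')"
    "h (c *\<^sub>C x) y = (\<lambda>x' y'. c *\<^sub>C h x y x' y')"
    "h x (c *\<^sub>C y) = (\<lambda>x' y'. c *\<^sub>C h x y x' y')"
    by (intro ext; rule cbilinearD[OF h'])+
  then show "tensor_lift (h (x + x1) y) t = tensor_lift (h x y) t + tensor_lift (h x1 y) t"
    "tensor_lift (h x (y + y1)) t = tensor_lift (h x y) t + tensor_lift (h x y1) t"
    "tensor_lift (h (c *\<^sub>C x) y) t = c *\<^sub>C tensor_lift (h x y) t"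
    "tensor_lift (h x (c *\<^sub>C y)) t = c *\<^sub>C tensor_lift (h x y) t"
    by (simp_all only: tensor_lift_add[OF h h] tensor_lift_scale[OF h])
qed

lemma cbilinear_tensor_lift_left:
  assumes h: "\<And>z. cbilinear (h z)" and h': "\<And>x y. clinear (\<lambda>z. h z x y)"
  shows "cbilinear (\<lambda>t z. tensor_lift (h z) t)"
proof (rule cbilinearI)
  fix t t' c z z'
  show "tensor_lift (h z) (t + t') = tensor_lift (h z) t + tensor_lift (h z) t'"
    "tensor_lift (h z) (c *\<^sub>C t) = c *\<^sub>C tensor_lift (h z) t"
    by (simp_all add: clinear_add[OF clinear_tensor_lift[OF h]] clinear_scale[OF clinear_tensor_lift[OF h]])
  have "h (z + z') = (\<lambda>x y. h z x y + h z' x y)" "h (c *\<^sub>C z) = (\<lambda>x y. c *\<^sub>C h z x y)"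
    by (intro ext; simp add: clinear_add[OF h'] clinear_scale[OF h'])+
  then show "tensor_lift (h (z + z')) t = tensor_lift (h z) t + tensor_lift (h z') t"
    "tensor_lift (h (c *\<^sub>C z)) t = c *\<^sub>C tensor_lift (h z) t"
    by (simp_all only: tensor_lift_add[OF h h] tensor_lift_scale[OF h])
qed

lemma cbilinear_compose:
  assumes "cbilinear h" "clinear f" "clinear g"
  shows "cbilinear (\<lambda>x y. h (f x) (g y))"
  by (rule cbilinearI) (simp_all add: cbilinearD[OF assms(1)]
      assms(2,3)[THEN clinear_add] assms(2,3)[THEN clinear_scale])

lemma cbilinear_mult: "cbilinear ((*) :: 'a::complex_algebra \<Rightarrow> _)"
  by (rule cbilinearI) (simp_all add: algebra_simps mult_scaleC_left mult_scaleC_right)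

lemma clinear_mult: "clinear (\<lambda>x. a * x)" "clinear (\<lambda>x. x * a)" for a :: "'a::complex_algebra"
  using cbilinear_mult unfolding cbilinear_def by auto

lemma clinear_ident: "clinear (\<lambda>x. x)"
  by (rule clinearI) simp_all

definition tensor_map ::
    "('a::complex_vector \<Rightarrow> 'c::complex_vector) \<Rightarrow> ('b::complex_vector \<Rightarrow> 'd::complex_vector)
     \<Rightarrow> ('a, 'b) tensor \<Rightarrow> ('c, 'd) tensor"
  where "tensor_map f g = tensor_lift (\<lambda>x y. f x \<otimes> g y)"

definition tensor_assoc ::
    "(('a::complex_vector, 'b::complex_vector) tensor, 'c::complex_vector) tensor
     \<Rightarrow> ('a, ('b, 'c) tensor) tensor"
  where "tensor_assoc = tensor_lift (\<lambda>t z. tensor_lift (\<lambda>x y. x \<otimes> (y \<otimes> z)) t)"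

lemma cbilinear_tensor_map: "clinear f \<Longrightarrow> clinear g \<Longrightarrow> cbilinear (\<lambda>x y. f x \<otimes> g y)"
  by (rule cbilinear_compose[OF cbilinear_pure_tensor])

lemma tensor_map_pure: "clinear f \<Longrightarrow> clinear g \<Longrightarrow> tensor_map f g (x \<otimes> y) = f x \<otimes> g y"
  unfolding tensor_map_def by (intro tensor_lift_pure cbilinear_tensor_map)

lemma clinear_tensor_map: "clinear f \<Longrightarrow> clinear g \<Longrightarrow> clinear (tensor_map f g)"
  unfolding tensor_map_def by (intro clinear_tensor_lift cbilinear_tensor_map)

lemma tensor_lift_tensor_map:
  assumes "cbilinear h" "clinear f" "clinear g"
  shows "tensor_lift h (tensor_map f g t) = tensor_lift (\<lambda>x y. h (f x) (g y)) t"
  unfolding tensor_map_def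
  by (rule tensor_lift_cong_ext)
     (simp_all only: cbilinear_tensor_map[OF assms(2,3)] cbilinear_compose[OF assms]
        clinear_tensor_lift[OF assms(1)] tensor_lift_pure[OF assms(1)])

lemma cbilinear_assoc_aux:
  "cbilinear (\<lambda>x y. x \<otimes> (y \<otimes> z))" "clinear (\<lambda>z. x \<otimes> (y \<otimes> z))"
proof -
  show "cbilinear (\<lambda>x y. x \<otimes> (y \<otimes> z))" by (rule cbilinearI) (simp_all only: pure_tensor_simps)
  show "clinear (\<lambda>z. x \<otimes> (y \<otimes> z))" by (rule clinearI) (simp_all only: pure_tensor_simps)
qed

lemma cbilinear_assoc: "cbilinear (\<lambda>t z. tensor_lift (\<lambda>x y. x \<otimes> (y \<otimes> z)) t)"
  by (rule cbilinear_tensor_lift_left) (rule cbilinear_assoc_aux)+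

lemma clinear_tensor_assoc: "clinear tensor_assoc"
  unfolding tensor_assoc_def by (rule clinear_tensor_lift[OF cbilinear_assoc])

lemma tensor_assoc_pure: "tensor_assoc ((x \<otimes> y) \<otimes> z) = x \<otimes> (y \<otimes> z)"
  unfolding tensor_assoc_def
  by (simp only: tensor_lift_pure[OF cbilinear_assoc] tensor_lift_pure[OF cbilinear_assoc_aux(1)])

lemma tensor_ext3:
  fixes f g :: "(('a::complex_vector, 'b::complex_vector) tensor, 'c::complex_vector) tensor
    \<Rightarrow> 'd::complex_vector"
  assumes "clinear f" "clinear g" "\<And>x y z. f ((x \<otimes> y) \<otimes> z) = g ((x \<otimes> y) \<otimes> z)"
  shows "f t = g t"
proof (rule tensor_ext)
  fix s :: "('a, 'b) tensor" and z :: 'c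
  have *: "clinear (\<lambda>s::('a, 'b) tensor. s \<otimes> z)"
    by (rule clinearI) (simp_all only: pure_tensor_simps)
  show "f (s \<otimes> z) = g (s \<otimes> z)"
    by (rule tensor_ext[where f = "\<lambda>s. f (s \<otimes> z)"])
       (rule clinear_compose[OF assms(1) *] clinear_compose[OF assms(2) *] assms(3))+
qed fact+

instantiation tensor :: (complex_algebra, complex_algebra) complex_algebra
begin

definition one_tensor :: "('a, 'b) tensor" where "1 = 1 \<otimes> 1"

definition times_tensor :: "('a, 'b) tensor \<Rightarrow> ('a, 'b) tensor \<Rightarrow> ('a, 'b) tensor"
  where "s * t = tensor_lift (\<lambda>x y. tensor_lift (\<lambda>x' y'. (x * x') \<otimes> (y * y')) t) s"

lemma times_aux:
  fixes x :: 'a and y :: 'b and t :: "('a, 'b) tensor"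
  shows "cbilinear (\<lambda>x' y'. (x * x') \<otimes> (y * y'))"
    "cbilinear (\<lambda>x y. tensor_lift (\<lambda>x' y'. (x * x') \<otimes> (y * y')) t)"
proof -
  have *: "cbilinear (\<lambda>x' y'. (x * x') \<otimes> (y * y'))" for x :: 'a and y :: 'b
    by (intro cbilinear_compose[OF cbilinear_pure_tensor] clinear_mult)
  then show "cbilinear (\<lambda>x' y'. (x * x') \<otimes> (y * y'))" .
  show "cbilinear (\<lambda>x y. tensor_lift (\<lambda>x' y'. (x * x') \<otimes> (y * y')) t)"
    by (intro cbilinear_tensor_lift * cbilinear_compose[OF cbilinear_pure_tensor] clinear_mult)
qed

lemma times_pure: "(x \<otimes> y) * (x' \<otimes> y') = (x * x') \<otimes> (y * y')"
  for x x' :: 'a and y y' :: 'b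
  unfolding times_tensor_def
  by (subst tensor_lift_pure[OF times_aux(2)], rule tensor_lift_pure[OF times_aux(1)])

lemma clinear_times:
  fixes s t :: "('a, 'b) tensor"
  shows "clinear (\<lambda>t. s * t)" and "clinear (\<lambda>s. s * t)"
proof -
  show "clinear (\<lambda>s. s * t)"
    unfolding times_tensor_def by (rule clinear_tensor_lift[OF times_aux(2)])
  have l: "clinear (\<lambda>s. s * t)" for t :: "('a, 'b) tensor"
    unfolding times_tensor_def by (rule clinear_tensor_lift[OF times_aux(2)])
  have p: "clinear (\<lambda>t. (x \<otimes> y) * t)" for x :: 'a and y :: 'b
    unfolding times_tensor_def
    unfolding tensor_lift_pure[OF times_aux(2)] by (rule clinear_tensor_lift[OF times_aux(1)])
  show "clinear (\<lambda>t. s * t)"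
  proof (rule clinearI)
    fix t t' c
    show "s * (t + t') = s * t + s * t'"
      by (rule tensor_ext[where f = "\<lambda>s. s * (t + t')"]; (rule clinearI)?)
        (simp_all add: clinear_scale[OF l] clinear_add[OF l] clinear_add[OF p] scaleC_add_right)
    show "s * (c *\<^sub>C t) = c *\<^sub>C (s * t)"
      by (rule tensor_ext[where f = "\<lambda>s. s * (c *\<^sub>C t)"]; (rule clinearI)?)
        (simp_all add: clinear_scale[OF l] clinear_add[OF l] scaleC_add_right
          clinear_scale[OF p] scaleC_scaleC mult.commute)
  qed
qed

instance
proof
  fix r s t :: "('a, 'b) tensor" and c
  note lin = clinear_times(1)[THEN clinear_add] clinear_times(1)[THEN clinear_scale]
    clinear_times(2)[THEN clinear_add] clinear_times(2)[THEN clinear_scale]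
  show "(r + s) * t = r * t + s * t" "r * (s + t) = r * s + r * t"
    "c *\<^sub>C s * t = c *\<^sub>C (s * t)" "s * c *\<^sub>C t = c *\<^sub>C (s * t)"
    by (simp_all add: lin)
  show "1 * t = t"
    by (rule tensor_ext[where f = "\<lambda>t. 1 * t"])
       (simp_all add: clinear_times clinear_ident one_tensor_def times_pure)
  show "t * 1 = t"
    by (rule tensor_ext[where f = "\<lambda>t. t * 1"])
       (simp_all add: clinear_times clinear_ident one_tensor_def times_pure)
  show "r * s * t = r * (s * t)"
  proof (rule tensor_ext[where f = "\<lambda>r. r * s * t"])
    show "clinear (\<lambda>r. r * s * t)" "clinear (\<lambda>r. r * (s * t))"
      by (rule clinearI; simp add: lin)+
    fix x :: 'a and y :: 'b
    show "(x \<otimes> y) * s * t = (x \<otimes> y) * (s * t)"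
    proof (rule tensor_ext[where f = "\<lambda>s. (x \<otimes> y) * s * t"])
      show "clinear (\<lambda>s. (x \<otimes> y) * s * t)" "clinear (\<lambda>s. (x \<otimes> y) * (s * t))"
        by (rule clinearI; simp add: lin)+
      fix x' :: 'a and y' :: 'b
      show "(x \<otimes> y) * (x' \<otimes> y') * t = (x \<otimes> y) * ((x' \<otimes> y') * t)"
      proof (rule tensor_ext[where f = "\<lambda>t. (x \<otimes> y) * (x' \<otimes> y') * t"])
        show "clinear (\<lambda>t. (x \<otimes> y) * (x' \<otimes> y') * t)" "clinear (\<lambda>t. (x \<otimes> y) * ((x' \<otimes> y') * t))"
          by (rule clinearI; simp add: lin)+
      qed (simp add: times_pure mult.assoc)
    qed
  qed
qed

end

lemma pure_tensor_mult:
  "(x \<otimes> y) * (x' \<otimes> y') = (x * x') \<otimes> (y * y')"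
  for x x' :: "'a::complex_algebra" and y y' :: "'b::complex_algebra"
  by (rule times_pure)

lemma algebra_hom_tensor_lift:
  fixes h :: "'a::complex_algebra \<Rightarrow> 'b::complex_algebra \<Rightarrow> 'c::complex_algebra"
  assumes h: "cbilinear h" and "h 1 1 = 1"
    and hm: "\<And>x x' y y'. h (x * x') (y * y') = h x y * h x' y'"
  shows "algebra_hom (tensor_lift h)"
  unfolding algebra_hom_def
proof (intro conjI allI)
  show l: "clinear (tensor_lift h)" by (rule clinear_tensor_lift[OF h])
  show "tensor_lift h 1 = 1" by (simp add: one_tensor_def tensor_lift_pure[OF h] assms)
  fix s t
  note lin = clinear_add[OF l] clinear_scale[OF l] mult_scaleC_left mult_scaleC_right
  show "tensor_lift h (s * t) = tensor_lift h s * tensor_lift h t"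
  proof (rule tensor_ext[where f = "\<lambda>s. tensor_lift h (s * t)"])
    show "clinear (\<lambda>s. tensor_lift h (s * t))" "clinear (\<lambda>s. tensor_lift h s * tensor_lift h t)"
      by (rule clinearI; simp add: lin distrib_right)+
    fix x y
    show "tensor_lift h ((x \<otimes> y) * t) = tensor_lift h (x \<otimes> y) * tensor_lift h t"
    proof (rule tensor_ext[where f = "\<lambda>t. tensor_lift h ((x \<otimes> y) * t)"])
      show "clinear (\<lambda>t. tensor_lift h ((x \<otimes> y) * t))"
        "clinear (\<lambda>t. tensor_lift h (x \<otimes> y) * tensor_lift h t)"
        by (rule clinearI; simp add: lin distrib_left)+
    qed (simp add: pure_tensor_mult tensor_lift_pure[OF h] hm)
  qed
qed


section \<open>Bialgebras and antipodes\<close>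

locale bialgebra =
  fixes comult :: "'a::complex_algebra \<Rightarrow> ('a, 'a) tensor" and counit :: "'a \<Rightarrow> complex"
  assumes comult_hom: "algebra_hom comult"
    and counit_hom: "algebra_hom counit"
    and coassoc: "tensor_assoc (tensor_map comult (\<lambda>y. y) (comult x)) = tensor_map (\<lambda>y. y) comult (comult x)"
    and counit_left: "tensor_lift (\<lambda>y z. counit y *\<^sub>C z) (comult x) = x"
    and counit_right: "tensor_lift (\<lambda>y z. counit z *\<^sub>C y) (comult x) = x"

abbreviation commutator :: "'a::complex_algebra \<Rightarrow> 'a \<Rightarrow> 'a"
  where "commutator x y \<equiv> x * y - y * x"

definition center :: "'a::complex_algebra set"
  where "center = {z. \<forall>x. z * x = x * z}"

definition antipode ::
    "('a::complex_algebra \<Rightarrow> ('a, 'a) tensor) \<Rightarrow> ('a \<Rightarrow> complex) \<Rightarrow> ('a \<Rightarrow> 'a) \<Rightarrow> bool"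
  where "antipode comult counit S \<longleftrightarrow> clinear S \<and>
    (\<forall>x. tensor_lift (\<lambda>y z. S y * z) (comult x) = counit x *\<^sub>C 1 \<and>
         tensor_lift (\<lambda>y z. y * S z) (comult x) = counit x *\<^sub>C 1)"

definition convolution ::
    "('a::complex_vector \<Rightarrow> ('a, 'a) tensor) \<Rightarrow> ('a \<Rightarrow> complex) \<Rightarrow> ('a \<Rightarrow> complex) \<Rightarrow> 'a \<Rightarrow> complex"
  where "convolution comult u v f = tensor_lift (\<lambda>x y. u x * v y) (comult f)"

lemma cbilinear_functionals:
  fixes u :: "'a::complex_vector \<Rightarrow> complex" and v :: "'b::complex_vector \<Rightarrow> complex"
  assumes "clinear u" "clinear v"
  shows "cbilinear (\<lambda>x y. u x * v y)"
  using cbilinear_compose[OF cbilinear_mult assms] .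

lemma cbilinear_scaled:
  fixes u :: "'a::complex_vector \<Rightarrow> complex"
  assumes "clinear u"
  shows "cbilinear (\<lambda>x z. u x *\<^sub>C z)" "cbilinear (\<lambda>z x. u x *\<^sub>C z)"
  by (rule cbilinearI; simp add: clinear_add[OF assms] clinear_scale[OF assms]
      scaleC_add_left scaleC_add_right scaleC_scaleC mult.commute)+

lemma algebra_hom_compose:
  assumes "algebra_hom f" "algebra_hom g"
  shows "algebra_hom (\<lambda>x. f (g x))"
  using assms clinear_compose[of f g] unfolding algebra_hom_def by simp

lemma algebra_hom_tensor_map:
  assumes "algebra_hom f" "algebra_hom g"
  shows "algebra_hom (tensor_map f g)"
  unfolding tensor_map_def
proof (rule algebra_hom_tensor_lift)
  show "cbilinear (\<lambda>x y. f x \<otimes> g y)"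
    using assms unfolding algebra_hom_def by (intro cbilinear_tensor_map) auto
  show "f 1 \<otimes> g 1 = 1"
    using assms unfolding algebra_hom_def one_tensor_def by simp
  fix x x' y y'
  show "f (x * x') \<otimes> g (y * y') = (f x \<otimes> g y) * (f x' \<otimes> g y')"
    using assms unfolding algebra_hom_def by (simp add: pure_tensor_mult)
qed

lemma algebra_hom_ident: "algebra_hom (\<lambda>x. x)"
  by (simp add: algebra_hom_def clinear_ident)

lemma algebra_hom_tensor_assoc: "algebra_hom tensor_assoc"
  unfolding tensor_assoc_def
proof (rule algebra_hom_tensor_lift[OF cbilinear_assoc])
  let ?A = "\<lambda>t z. tensor_lift (\<lambda>x y. x \<otimes> (y \<otimes> z)) t"
  have pure: "?A (x \<otimes> y) z = x \<otimes> (y \<otimes> z)" for x y z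
    by (rule tensor_lift_pure[OF cbilinear_assoc_aux(1)])
  show "?A 1 1 = 1" unfolding one_tensor_def pure ..
  fix s t :: "('a, 'b) tensor" and z z' :: 'c
  note lin = cbilinearD(1,2)[OF cbilinear_assoc]
  show "?A (s * t) (z * z') = ?A s z * ?A t z'"
  proof (rule tensor_ext[where f = "\<lambda>s. ?A (s * t) (z * z')"])
    show "clinear (\<lambda>s. ?A (s * t) (z * z'))" "clinear (\<lambda>s. ?A s z * ?A t z')"
      by (rule clinearI; simp only: lin distrib_right mult_scaleC_left)+
    fix x :: 'a and y :: 'b
    show "?A ((x \<otimes> y) * t) (z * z') = ?A (x \<otimes> y) z * ?A t z'"
    proof (rule tensor_ext[where f = "\<lambda>t. ?A ((x \<otimes> y) * t) (z * z')"])
      show "clinear (\<lambda>t. ?A ((x \<otimes> y) * t) (z * z'))" "clinear (\<lambda>t. ?A (x \<otimes> y) z * ?A t z')"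
        by (rule clinearI; simp only: lin distrib_left mult_scaleC_right)+
    qed (simp only: pure pure_tensor_mult)
  qed
qed

context bialgebra
begin

lemma clinear_comult: "clinear comult" and clinear_counit: "clinear counit"
  using comult_hom counit_hom by (simp_all add: algebra_hom_def)

lemma clinear_convolution:
  assumes "clinear u" "clinear v"
  shows "clinear (convolution comult u v)"
  unfolding convolution_def
  by (rule clinear_compose[OF clinear_tensor_lift[OF cbilinear_functionals[OF assms]] clinear_comult])

lemma convolution_unit:
  assumes "clinear u"
  shows "convolution comult counit u = u" "convolution comult u counit = u"
proof -
  have "tensor_lift (\<lambda>x y. counit x * u y) t = u (tensor_lift (\<lambda>x y. counit x *\<^sub>C y) t)" for t
    by (rule tensor_lift_cong_ext[OF cbilinear_scaled(1)[OF clinear_counit]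
          cbilinear_functionals[OF clinear_counit assms] assms, symmetric])
       (simp add: clinear_scale[OF assms])
  moreover have "tensor_lift (\<lambda>x y. u x * counit y) t = u (tensor_lift (\<lambda>x y. counit y *\<^sub>C x) t)" for t
    by (rule tensor_lift_cong_ext[OF cbilinear_scaled(2)[OF clinear_counit]
          cbilinear_functionals[OF assms clinear_counit] assms, symmetric])
       (simp add: clinear_scale[OF assms])
  ultimately show "convolution comult counit u = u" "convolution comult u counit = u"
    by (simp_all add: convolution_def fun_eq_iff counit_left counit_right)
qed

lemma convolution_assoc:
  assumes u: "clinear u" and v: "clinear v" and w: "clinear w"
  shows "convolution comult (convolution comult u v) w = convolution comult u (convolution comult v w)"
proof
  fix f
  define E where "E = tensor_lift (\<lambda>x y. u x * v y)"
  define E' where "E' = tensor_lift (\<lambda>x y. v x * w y)"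
  have E: "clinear E" and E': "clinear E'"
    unfolding E_def E'_def by (intro clinear_tensor_lift cbilinear_functionals u v w)+
  note EE = cbilinear_functionals[OF E w] and EE' = cbilinear_functionals[OF u E']
  have "convolution comult (convolution comult u v) w f =
      tensor_lift (\<lambda>t z. E t * w z) (tensor_map comult (\<lambda>y. y) (comult f))"
    unfolding tensor_lift_tensor_map[OF EE clinear_comult clinear_ident]
    by (simp add: convolution_def E_def)
  also have "\<dots> = tensor_lift (\<lambda>x t. u x * E' t) (tensor_assoc (tensor_map comult (\<lambda>y. y) (comult f)))"
  proof (rule tensor_ext3[where g = "\<lambda>t. tensor_lift (\<lambda>x t. u x * E' t) (tensor_assoc t)"])
    show "clinear (tensor_lift (\<lambda>t z. E t * w z))" by (rule clinear_tensor_lift[OF EE])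
    show "clinear (\<lambda>t. tensor_lift (\<lambda>x t. u x * E' t) (tensor_assoc t))"
      by (rule clinear_compose[OF clinear_tensor_lift[OF EE'] clinear_tensor_assoc])
    fix x y z
    show "tensor_lift (\<lambda>t z. E t * w z) ((x \<otimes> y) \<otimes> z) =
        tensor_lift (\<lambda>x t. u x * E' t) (tensor_assoc ((x \<otimes> y) \<otimes> z))"
      unfolding tensor_assoc_pure tensor_lift_pure[OF EE] tensor_lift_pure[OF EE']
      unfolding E_def E'_def tensor_lift_pure[OF cbilinear_functionals[OF u v]]
        tensor_lift_pure[OF cbilinear_functionals[OF v w]]
      by simp
  qed
  also have "\<dots> = tensor_lift (\<lambda>x t. u x * E' t) (tensor_map (\<lambda>y. y) comult (comult f))"
    by (simp only: coassoc)
  also have "\<dots> = convolution comult u (convolution comult v w) f"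
    unfolding tensor_lift_tensor_map[OF EE' clinear_ident clinear_comult]
    by (simp add: convolution_def E'_def)
  finally show "convolution comult (convolution comult u v) w f =
    convolution comult u (convolution comult v w) f" .
qed

lemma convolution_add:
  assumes "clinear u" "clinear v" "clinear w"
  shows "convolution comult (\<lambda>x. u x + v x) w = (\<lambda>x. convolution comult u w x + convolution comult v w x)"
    "convolution comult w (\<lambda>x. u x + v x) = (\<lambda>x. convolution comult w u x + convolution comult w v x)"
  using assms
  by (simp_all add: convolution_def fun_eq_iff distrib_left distrib_right tensor_lift_add cbilinear_functionals)

lemma convolution_scale:
  assumes "clinear u" "clinear v"
  shows "convolution comult (\<lambda>x. c * u x) v = (\<lambda>x. c * convolution comult u v x)"
    "convolution comult u (\<lambda>x. c * v x) = (\<lambda>x. c * convolution comult u v x)"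
  using tensor_lift_scale[OF cbilinear_functionals[OF assms], of c]
  by (simp_all add: convolution_def fun_eq_iff mult.assoc mult.left_commute)

end


section \<open>The bialgebra S03\<close>

text \<open>Lists over the alphabet form the free monoid, so that finitely supported functions on them,
  with the convolution product, are the free algebra.\<close>

instantiation list :: (type) monoid_add
begin
definition zero_list :: "'a list" where "0 = []"
definition plus_list :: "'a list \<Rightarrow> 'a list \<Rightarrow> 'a list" where "u + v = u @ v"
instance by standard (simp_all add: zero_list_def plus_list_def)
end

text \<open>The multiples \<open>p * [x, y] * q\<close> span the two-sided ideal generated by the monomial relations.\<close>

datatype gen = Gen_a | Gen_b | Gen_c | Gen_d

definition forbidden :: "(gen \<times> gen) set" where
  "forbidden = {(Gen_b, Gen_b), (Gen_c, Gen_c), (Gen_a, Gen_d), (Gen_d, Gen_a),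
     (Gen_a, Gen_b), (Gen_b, Gen_d), (Gen_d, Gen_c), (Gen_c, Gen_a)}"

definition basis_word :: "gen list \<Rightarrow> bool"
  where "basis_word w \<longleftrightarrow> \<not> (\<exists>u v x y. w = u @ [x, y] @ v \<and> (x, y) \<in> forbidden)"

definition S03_relators :: "(gen list \<Rightarrow>\<^sub>0 complex) set"
  where "S03_relators = {p * Poly_Mapping.single [x, y] 1 * q | p x y q. (x, y) \<in> forbidden}"

quotient_type S03 = "gen list \<Rightarrow>\<^sub>0 complex" / "\<lambda>p q. p - q \<in> cvec.span S03_relators"
  by (rule equivp_span)

lemma S03_ideal_mult:
  assumes "r \<in> cvec.span S03_relators"
  shows "p * r \<in> cvec.span S03_relators" "r * p \<in> cvec.span S03_relators"
proof -
  have rel: "p * s \<in> S03_relators" "s * p \<in> S03_relators" if s_rel: "s \<in> S03_relators" for s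
  proof -
    obtain p' x y q' where s: "s = p' * Poly_Mapping.single [x, y] 1 * q'" and xy: "(x, y) \<in> forbidden"
      using s_rel unfolding S03_relators_def by blast
    have "p * s = (p * p') * Poly_Mapping.single [x, y] 1 * q'"
      "s * p = p' * Poly_Mapping.single [x, y] 1 * (q' * p)"
      by (simp_all only: s mult.assoc)
    with xy show "p * s \<in> S03_relators" "s * p \<in> S03_relators"
      unfolding S03_relators_def by blast+
  qed
  show "p * r \<in> cvec.span S03_relators" using assms
    by (induction rule: cvec.span_induct_alt)
       (simp_all add: cvec.span_zero distrib_left poly_mapping_scaleC_right cvec.span_add
          cvec.span_scale cvec.span_base rel)
  show "r * p \<in> cvec.span S03_relators" using assms
    by (induction rule: cvec.span_induct_alt)
       (simp_all add: cvec.span_zero distrib_right poly_mapping_scaleC_left cvec.span_add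
          cvec.span_scale cvec.span_base rel)
qed

lemma S03_ideal_cong:
  assumes "p - p' \<in> cvec.span S03_relators" "q - q' \<in> cvec.span S03_relators"
  shows "p * q - p' * q' \<in> cvec.span S03_relators"
proof -
  have "p * q - p' * q' = (p - p') * q + p' * (q - q')" by (simp add: algebra_simps)
  then show ?thesis
    by (simp only: cvec.span_add[OF S03_ideal_mult(2)[OF assms(1)] S03_ideal_mult(1)[OF assms(2)]])
qed

instantiation S03 :: complex_algebra
begin
lift_definition zero_S03 :: S03 is 0 .
lift_definition one_S03 :: S03 is 1 .
lift_definition plus_S03 :: "S03 \<Rightarrow> S03 \<Rightarrow> S03" is "(+)" by (rule span_congs)
lift_definition minus_S03 :: "S03 \<Rightarrow> S03 \<Rightarrow> S03" is "(-)" by (rule span_congs)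
lift_definition uminus_S03 :: "S03 \<Rightarrow> S03" is uminus by (rule span_congs)
lift_definition scaleC_S03 :: "complex \<Rightarrow> S03 \<Rightarrow> S03" is scaleC by (rule span_congs)
lift_definition times_S03 :: "S03 \<Rightarrow> S03 \<Rightarrow> S03" is "(*)" by (rule S03_ideal_cong)
instance
  by standard (transfer; simp add: cvec.span_zero algebra_simps scaleC_add_right scaleC_add_left
    scaleC_scaleC scaleC_one poly_mapping_scaleC_left poly_mapping_scaleC_right)+
end

lift_definition S03_word :: "gen list \<Rightarrow> S03" is "\<lambda>w. Poly_Mapping.single w 1" .

abbreviation S03_gen :: "gen \<Rightarrow> S03" where "S03_gen g \<equiv> S03_word [g]"
abbreviation a_gen :: S03  (\<open>\<a>\<close>) where "\<a> \<equiv> S03_gen Gen_a"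
abbreviation b_gen :: S03  (\<open>\<b>\<close>) where "\<b> \<equiv> S03_gen Gen_b"
abbreviation c_gen :: S03  (\<open>\<c>\<close>) where "\<c> \<equiv> S03_gen Gen_c"
abbreviation d_gen :: S03  (\<open>\<d>\<close>) where "\<d> \<equiv> S03_gen Gen_d"

lemma S03_word_Nil: "S03_word [] = 1"
  by (transfer, fold zero_list_def) (simp add: cvec.span_zero)

lemma S03_word_append: "S03_word (u @ v) = S03_word u * S03_word v"
  by transfer (simp add: mult_single plus_list_def cvec.span_zero)

lemma S03_word_Cons: "S03_word (g # w) = S03_gen g * S03_word w"
  using S03_word_append[of "[g]" w] by simp

lemma S03_gen_mult_forbidden: "(x, y) \<in> forbidden \<Longrightarrow> S03_gen x * S03_gen y = 0"
  unfolding S03_word_append[symmetric]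
proof transfer
  fix x y assume *: "(x, y) \<in> forbidden"
  have "1 * Poly_Mapping.single [x, y] 1 * 1 \<in> S03_relators"
    unfolding S03_relators_def using * by blast
  then show "Poly_Mapping.single ([x] @ [y]) 1 - 0 \<in> cvec.span S03_relators"
    by (simp add: cvec.span_base)
qed

lemma S03_word_eq_0:
  assumes "\<not> basis_word w"
  shows "S03_word w = 0"
proof -
  obtain u v x y where w: "w = u @ ([x] @ [y]) @ v" and xy: "(x, y) \<in> forbidden"
    using assms unfolding basis_word_def by auto
  show ?thesis
    unfolding w S03_word_append S03_gen_mult_forbidden[OF xy] by simp
qed

lemma abs_S03_surj: "\<exists>p. t = abs_S03 p"
  using Quotient3_abs_rep[OF Quotient3_S03, of t] by metis

lemma clinear_abs_S03: "clinear abs_S03"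
  by (rule clinearI) (simp_all add: plus_S03.abs_eq scaleC_S03.abs_eq)

lemma S03_clinear_ext:
  fixes f g :: "S03 \<Rightarrow> 'a::complex_vector"
  assumes "clinear f" "clinear g" "\<And>w. basis_word w \<Longrightarrow> f (S03_word w) = g (S03_word w)"
  shows "f x = g x"
proof -
  have "f (abs_S03 p) = g (abs_S03 p)" for p
  proof (rule poly_mapping_clinear_ext[where f = "\<lambda>p. f (abs_S03 p)"])
    show "clinear (\<lambda>p. f (abs_S03 p))" by (rule clinear_compose[OF assms(1) clinear_abs_S03])
    show "clinear (\<lambda>p. g (abs_S03 p))" by (rule clinear_compose[OF assms(2) clinear_abs_S03])
    show "f (abs_S03 (Poly_Mapping.single w 1)) = g (abs_S03 (Poly_Mapping.single w 1))" for w
      unfolding S03_word.abs_eq[symmetric]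
      by (cases "basis_word w") (simp_all add: assms(3) S03_word_eq_0 clinear_0[OF assms(1)] clinear_0[OF assms(2)])
  qed
  then show ?thesis using abs_S03_surj[of x] by auto
qed

lemma S03_lift:
  fixes F :: "(gen list \<Rightarrow>\<^sub>0 complex) \<Rightarrow> 'a::complex_vector"
  assumes F: "clinear F" and z: "\<And>r. r \<in> S03_relators \<Longrightarrow> F r = 0"
  obtains f where "clinear f" "\<And>p. f (abs_S03 p) = F p"
proof
  define f where "f x = F (rep_S03 x)" for x
  show fabs: "f (abs_S03 p) = F p" for p
  proof -
    have "rep_S03 (abs_S03 p) - p \<in> cvec.span S03_relators"
      by (rule Quotient3_rep_abs[OF Quotient3_S03]) (simp add: cvec.span_zero)
    from clinear_zero_on_span[OF F z this] show ?thesis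
      by (simp add: f_def clinear_diff[OF F])
  qed
  show "clinear f"
  proof (rule clinearI)
    fix s t c
    obtain p q where "s = abs_S03 p" "t = abs_S03 q" using abs_S03_surj by blast
    then show "f (s + t) = f s + f t" "f (c *\<^sub>C t) = c *\<^sub>C f t"
      by (simp_all add: plus_S03.abs_eq scaleC_S03.abs_eq fabs clinear_add[OF F] clinear_scale[OF F])
  qed
qed

text \<open>The linear map with prescribed values on the basis of words.\<close>

definition S03_linear :: "(gen list \<Rightarrow> 'a::complex_vector) \<Rightarrow> S03 \<Rightarrow> 'a"
  where "S03_linear \<phi> = (THE f. clinear f \<and> (\<forall>w. basis_word w \<longrightarrow> f (S03_word w) = \<phi> w))"

lemma S03_linear_ex1:
  fixes \<phi> :: "gen list \<Rightarrow> 'a::complex_vector"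
  shows "\<exists>!f. clinear f \<and> (\<forall>w. basis_word w \<longrightarrow> f (S03_word w) = \<phi> w)"
proof -
  define \<psi> where "\<psi> w = (if basis_word w then \<phi> w else 0)" for w
  have \<psi>: "\<psi> (u @ [x, y] @ v) = 0" if "(x, y) \<in> forbidden" for u v x y
    using that by (auto simp: \<psi>_def basis_word_def)
  have zero: "lin_ext \<psi> (p * Poly_Mapping.single [x, y] 1 * q) = 0" if xy: "(x, y) \<in> forbidden" for p q x y
  proof -
    note lin = clinear_add[OF clinear_lin_ext] clinear_scale[OF clinear_lin_ext]
    have "lin_ext \<psi> (p * Poly_Mapping.single [x, y] 1 * q) = (\<lambda>p. 0) p"
    proof (rule poly_mapping_clinear_ext[where f = "\<lambda>p. lin_ext \<psi> (p * Poly_Mapping.single [x, y] 1 * q)"])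
      show "clinear (\<lambda>p. lin_ext \<psi> (p * Poly_Mapping.single [x, y] 1 * q))"
        by (rule clinearI) (simp_all only: distrib_right lin poly_mapping_scaleC_left)
      show "clinear (\<lambda>p::gen list \<Rightarrow>\<^sub>0 complex. 0 :: 'a)" by (rule clinearI) simp_all
      fix u
      have "lin_ext \<psi> (Poly_Mapping.single u 1 * Poly_Mapping.single [x, y] 1 * q) = (\<lambda>q. 0) q"
      proof (rule poly_mapping_clinear_ext[where f = "\<lambda>q. lin_ext \<psi> (Poly_Mapping.single u 1 * Poly_Mapping.single [x, y] 1 * q)"])
        show "clinear (\<lambda>q. lin_ext \<psi> (Poly_Mapping.single u 1 * Poly_Mapping.single [x, y] 1 * q))"
          by (rule clinearI) (simp_all only: distrib_left lin poly_mapping_scaleC_right)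
        show "clinear (\<lambda>p::gen list \<Rightarrow>\<^sub>0 complex. 0 :: 'a)" by (rule clinearI) simp_all
        show "lin_ext \<psi> (Poly_Mapping.single u 1 * Poly_Mapping.single [x, y] 1 * Poly_Mapping.single v 1) = 0" for v
          using \<psi>[OF xy, of u v] by (simp add: mult_single plus_list_def)
      qed
      then show "lin_ext \<psi> (Poly_Mapping.single u 1 * Poly_Mapping.single [x, y] 1 * q) = 0" .
    qed
    then show ?thesis .
  qed
  have "lin_ext \<psi> r = 0" if "r \<in> S03_relators" for r
    using that zero unfolding S03_relators_def by auto
  from S03_lift[OF clinear_lin_ext this]
  obtain f where f: "clinear f" "\<And>p. f (abs_S03 p) = lin_ext \<psi> p" by blast
  show ?thesis
  proof (intro ex1I[of _ f] conjI allI impI ext)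
    show "f (S03_word w) = \<phi> w" if "basis_word w" for w
      using that by (simp add: S03_word.abs_eq f(2) \<psi>_def scaleC_one)
    then show "g x = f x" if "clinear g \<and> (\<forall>w. basis_word w \<longrightarrow> g (S03_word w) = \<phi> w)" for g x
      using that by - (rule S03_clinear_ext[OF _ f(1)]; simp)
  qed (rule f(1))
qed

lemma clinear_S03_linear: "clinear (S03_linear \<phi>)"
  and S03_linear_word: "basis_word w \<Longrightarrow> S03_linear \<phi> (S03_word w) = \<phi> w"
  using theI'[OF S03_linear_ex1[of \<phi>]] unfolding S03_linear_def by blast+

text \<open>The algebra homomorphism with prescribed values on the generators. It exists exactly when
  these values satisfy the defining relations.\<close>

definition S03_hom :: "(gen \<Rightarrow> 'a::complex_algebra) \<Rightarrow> S03 \<Rightarrow> 'a"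
  where "S03_hom h = (THE f. algebra_hom f \<and> (\<forall>g. f (S03_gen g) = h g))"

lemma algebra_hom_word:
  fixes f :: "S03 \<Rightarrow> 'a::complex_algebra"
  assumes "algebra_hom f"
  shows "f (S03_word w) = prod_list (map (\<lambda>g. f (S03_gen g)) w)"
proof (induction w)
  case Nil
  then show ?case using assms by (simp add: S03_word_Nil algebra_hom_def)
next
  case (Cons g w)
  have "f (S03_word (g # w)) = f (S03_gen g) * f (S03_word w)"
    unfolding S03_word_Cons[of g w] using assms by (simp add: algebra_hom_def)
  then show ?case by (simp add: Cons.IH)
qed

lemma S03_hom_eqI:
  fixes f g :: "S03 \<Rightarrow> 'a::complex_algebra"
  assumes "algebra_hom f" "algebra_hom g" "\<And>x. f (S03_gen x) = g (S03_gen x)"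
  shows "f x = g x"
proof (rule S03_clinear_ext)
  show "clinear f" "clinear g" using assms(1,2) by (simp_all add: algebra_hom_def)
  show "f (S03_word w) = g (S03_word w)" for w
    using algebra_hom_word[OF assms(1), of w] algebra_hom_word[OF assms(2), of w]
    by (simp only: assms(3))
qed

lemma S03_hom_ex1:
  fixes h :: "gen \<Rightarrow> 'a::complex_algebra"
  assumes rel: "\<And>x y. (x, y) \<in> forbidden \<Longrightarrow> h x * h y = 0"
  shows "\<exists>!f. algebra_hom f \<and> (\<forall>g. f (S03_gen g) = h g)"
proof -
  define M where "M w = prod_list (map h w)" for w
  let ?F = "lin_ext M"
  note lin = clinear_add[OF clinear_lin_ext] clinear_scale[OF clinear_lin_ext]
  have mult: "?F (p * q) = ?F p * ?F q" for p q
  proof (rule poly_mapping_clinear_ext[where f = "\<lambda>p. ?F (p * q)"])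
    show "clinear (\<lambda>p. ?F (p * q))" "clinear (\<lambda>p. ?F p * ?F q)"
      by (rule clinearI; simp only: distrib_right lin poly_mapping_scaleC_left mult_scaleC_left)+
    fix u
    show "?F (Poly_Mapping.single u 1 * q) = ?F (Poly_Mapping.single u 1) * ?F q"
    proof (rule poly_mapping_clinear_ext[where f = "\<lambda>q. ?F (Poly_Mapping.single u 1 * q)"])
      show "clinear (\<lambda>q. ?F (Poly_Mapping.single u 1 * q))"
        "clinear (\<lambda>q. ?F (Poly_Mapping.single u 1) * ?F q)"
        by (rule clinearI; simp only: distrib_left lin poly_mapping_scaleC_right mult_scaleC_right)+
    qed (simp add: mult_single plus_list_def M_def scaleC_one)
  qed
  have "lin_ext M r = 0" if "r \<in> S03_relators" for r
    using that unfolding S03_relators_def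
    by (auto simp: mult M_def rel scaleC_one simp flip: mult.assoc)
  from S03_lift[OF clinear_lin_ext this]
  obtain f where f: "clinear f" "\<And>p. f (abs_S03 p) = ?F p" by blast
  have "algebra_hom f"
    unfolding algebra_hom_def
  proof (intro conjI allI f(1))
    have one: "1 = Poly_Mapping.single ([]::gen list) (1::complex)"
      unfolding zero_list_def[symmetric] by simp
    have "lin_ext M (Poly_Mapping.single [] 1) = 1" by (simp add: M_def scaleC_one)
    then show "f 1 = 1" unfolding one_S03.abs_eq f(2) one .
    fix x y
    obtain p q where "x = abs_S03 p" "y = abs_S03 q" using abs_S03_surj by blast
    then show "f (x * y) = f x * f y" by (simp add: times_S03.abs_eq f(2) mult)
  qed
  moreover have "f (S03_gen g) = h g" for g
    by (simp add: S03_word.abs_eq f(2) M_def scaleC_one)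
  ultimately show ?thesis
  proof (intro ex1I[of _ f] conjI allI ext)
    fix g x
    assume "algebra_hom g \<and> (\<forall>y. g (S03_gen y) = h y)" "algebra_hom f"
      and "\<And>y. f (S03_gen y) = h y"
    then show "g x = f x" by - (rule S03_hom_eqI; simp)
  qed
qed

lemma
  assumes "\<And>x y. (x, y) \<in> forbidden \<Longrightarrow> h x * h y = 0"
  shows algebra_hom_S03_hom: "algebra_hom (S03_hom h)"
    and S03_hom_gen: "S03_hom h (S03_gen g) = h g"
  using theI'[OF S03_hom_ex1[OF assms]] unfolding S03_hom_def by simp_all

primrec S03_comult_gen :: "gen \<Rightarrow> (S03, S03) tensor" where
  "S03_comult_gen Gen_a = \<a> \<otimes> \<a> + \<b> \<otimes> \<b> - \<c> \<otimes> \<c> + \<d> \<otimes> \<d>"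
| "S03_comult_gen Gen_b = \<a> \<otimes> \<b> + \<b> \<otimes> \<a> - \<c> \<otimes> \<d> + \<d> \<otimes> \<c>"
| "S03_comult_gen Gen_c = \<a> \<otimes> \<c> + \<c> \<otimes> \<a> - \<b> \<otimes> \<d> + \<d> \<otimes> \<b>"
| "S03_comult_gen Gen_d = \<a> \<otimes> \<d> + \<d> \<otimes> \<a> - \<b> \<otimes> \<c> + \<c> \<otimes> \<b>"

definition S03_comult :: "S03 \<Rightarrow> (S03, S03) tensor"
  where "S03_comult = S03_hom S03_comult_gen"

definition S03_counit :: "S03 \<Rightarrow> complex"
  where "S03_counit = S03_hom (\<lambda>g. if g = Gen_a then 1 else 0)"

lemma S03_gen_mult:
  "\<a> * \<b> = 0" "\<a> * \<d> = 0" "\<b> * \<b> = 0" "\<b> * \<d> = 0"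
  "\<c> * \<a> = 0" "\<c> * \<c> = 0" "\<d> * \<a> = 0" "\<d> * \<c> = 0"
  by (simp_all add: S03_gen_mult_forbidden forbidden_def)

lemma pure_tensor_0 [simp]: "0 \<otimes> y = 0" "x \<otimes> 0 = 0"
  using pure_tensor_simps(2)[of 0 0 y] pure_tensor_simps(4)[of x 0 0] by simp_all

lemma pure_tensor_minus: "(- x) \<otimes> y = - (x \<otimes> y)" "x \<otimes> (- y) = - (x \<otimes> y)"
  using pure_tensor_simps(2)[of "-1" x y] pure_tensor_simps(4)[of x "-1" y]
  by (simp_all add: scaleC_one)

lemma pure_tensor_diff:
  "(x - x') \<otimes> y = x \<otimes> y - x' \<otimes> y" "x \<otimes> (y - y') = x \<otimes> y - x \<otimes> y'"
  unfolding diff_conv_add_uminus pure_tensor_simps pure_tensor_minus by simp_all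

lemma S03_comult_relations: "(x, y) \<in> forbidden \<Longrightarrow> S03_comult_gen x * S03_comult_gen y = 0"
  unfolding forbidden_def
  by (auto simp: distrib_left distrib_right left_diff_distrib right_diff_distrib
      pure_tensor_mult S03_gen_mult)

lemma S03_comult_hom: "algebra_hom S03_comult"
  and S03_comult_gen: "S03_comult (S03_gen g) = S03_comult_gen g"
  unfolding S03_comult_def
  by (rule algebra_hom_S03_hom S03_hom_gen, erule S03_comult_relations)+

lemma S03_counit_hom: "algebra_hom S03_counit"
  and S03_counit_gen: "S03_counit (S03_gen g) = (if g = Gen_a then 1 else 0)"
  unfolding S03_counit_def
  by (rule algebra_hom_S03_hom S03_hom_gen, force simp: forbidden_def)+

global_interpretation S03: bialgebra S03_comult S03_counit
proof
  note lin_comult = S03_comult_hom[unfolded algebra_hom_def, THEN conjunct1]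
    and lin_counit = S03_counit_hom[unfolded algebra_hom_def, THEN conjunct1]
  show "algebra_hom S03_comult" by (rule S03_comult_hom)
  show "algebra_hom S03_counit" by (rule S03_counit_hom)
  fix x
  have map_l: "algebra_hom (tensor_map S03_comult (\<lambda>y. y))"
    and map_r: "algebra_hom (tensor_map (\<lambda>y. y) S03_comult)"
    by (intro algebra_hom_tensor_map S03_comult_hom algebra_hom_ident)+
  show "tensor_assoc (tensor_map S03_comult (\<lambda>y. y) (S03_comult x)) =
      tensor_map (\<lambda>y. y) S03_comult (S03_comult x)"
  proof (rule S03_hom_eqI[where f = "\<lambda>x. tensor_assoc (tensor_map S03_comult (\<lambda>y. y) (S03_comult x))"])
    show "algebra_hom (\<lambda>x. tensor_assoc (tensor_map S03_comult (\<lambda>y. y) (S03_comult x)))"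
      by (rule algebra_hom_compose[OF algebra_hom_tensor_assoc algebra_hom_compose[OF map_l S03_comult_hom]])
    show "algebra_hom (\<lambda>x. tensor_map (\<lambda>y. y) S03_comult (S03_comult x))"
      by (rule algebra_hom_compose[OF map_r S03_comult_hom])
    note lin = map_l[unfolded algebra_hom_def, THEN conjunct1] map_r[unfolded algebra_hom_def, THEN conjunct1]
      clinear_tensor_assoc
    note lins = lin(1)[THEN clinear_add] lin(2)[THEN clinear_add] lin(3)[THEN clinear_add]
      lin(1)[THEN clinear_diff] lin(2)[THEN clinear_diff] lin(3)[THEN clinear_diff]
    show "tensor_assoc (tensor_map S03_comult (\<lambda>y. y) (S03_comult (S03_gen g))) =
        tensor_map (\<lambda>y. y) S03_comult (S03_comult (S03_gen g))" for g
      by (cases g) (simp_all add: S03_comult_gen lins tensor_map_pure[OF lin_comult clinear_ident]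
          tensor_map_pure[OF clinear_ident lin_comult] pure_tensor_simps(1,3) pure_tensor_diff tensor_assoc_pure)
  qed
  show "tensor_lift (\<lambda>y z. S03_counit y *\<^sub>C z) (S03_comult x) = x"
  proof (rule S03_hom_eqI[where f = "\<lambda>x. tensor_lift (\<lambda>y z. S03_counit y *\<^sub>C z) (S03_comult x)"])
    note bil = cbilinear_scaled(1)[OF lin_counit]
    note lin = clinear_tensor_lift[OF bil]
    show "algebra_hom (\<lambda>x. tensor_lift (\<lambda>y z. S03_counit y *\<^sub>C z) (S03_comult x))"
      using S03_counit_hom unfolding algebra_hom_def
      by (intro algebra_hom_compose[OF algebra_hom_tensor_lift[OF bil] S03_comult_hom, unfolded algebra_hom_def])
         (simp_all add: scaleC_one mult_scaleC_left mult_scaleC_right scaleC_scaleC)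
    show "tensor_lift (\<lambda>y z. S03_counit y *\<^sub>C z) (S03_comult (S03_gen g)) = S03_gen g" for g
      by (cases g) (simp_all add: S03_comult_gen clinear_add[OF lin] clinear_diff[OF lin]
          tensor_lift_pure[OF bil] S03_counit_gen scaleC_one)
  qed (rule algebra_hom_ident)
  show "tensor_lift (\<lambda>y z. S03_counit z *\<^sub>C y) (S03_comult x) = x"
  proof (rule S03_hom_eqI[where f = "\<lambda>x. tensor_lift (\<lambda>y z. S03_counit z *\<^sub>C y) (S03_comult x)"])
    note bil = cbilinear_scaled(2)[OF lin_counit]
    note lin = clinear_tensor_lift[OF bil]
    show "algebra_hom (\<lambda>x. tensor_lift (\<lambda>y z. S03_counit z *\<^sub>C y) (S03_comult x))"
      using S03_counit_hom unfolding algebra_hom_def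
      by (intro algebra_hom_compose[OF algebra_hom_tensor_lift[OF bil] S03_comult_hom, unfolded algebra_hom_def])
         (simp_all add: scaleC_one mult_scaleC_left mult_scaleC_right scaleC_scaleC)
    show "tensor_lift (\<lambda>y z. S03_counit z *\<^sub>C y) (S03_comult (S03_gen g)) = S03_gen g" for g
      by (cases g) (simp_all add: S03_comult_gen clinear_add[OF lin] clinear_diff[OF lin]
          tensor_lift_pure[OF bil] S03_counit_gen scaleC_one)
  qed (rule algebra_hom_ident)
qed


section \<open>The dual algebra s03\<close>

definition functional_A :: "S03 \<Rightarrow> complex" where
  "functional_A = S03_linear (\<lambda>w. if w = replicate (length w) Gen_a then of_nat (length w) else 0)"

definition functional_B :: "S03 \<Rightarrow> complex" where
  "functional_B = S03_linear (\<lambda>w. if \<exists>k. w = Gen_b # replicate k Gen_a then 1 else 0)"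

definition functional_C :: "S03 \<Rightarrow> complex" where
  "functional_C = S03_linear (\<lambda>w. if \<exists>k. w = replicate k Gen_a @ [Gen_c] then 1 else 0)"

definition functional_D :: "S03 \<Rightarrow> complex" where
  "functional_D = S03_linear (\<lambda>w. if w = [Gen_d] then 1 else 0)"

text \<open>The unital subalgebra of the dual of \<open>S03\<close> generated by the four functionals.\<close>

inductive_set s03_functionals :: "(S03 \<Rightarrow> complex) set" where
  "functional_A \<in> s03_functionals"
| "functional_B \<in> s03_functionals"
| "functional_C \<in> s03_functionals"
| "functional_D \<in> s03_functionals"
| "S03_counit \<in> s03_functionals"
| "u \<in> s03_functionals \<Longrightarrow> v \<in> s03_functionals \<Longrightarrow> (\<lambda>f. u f + v f) \<in> s03_functionals"
| "u \<in> s03_functionals \<Longrightarrow> (\<lambda>f. c * u f) \<in> s03_functionals"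
| "u \<in> s03_functionals \<Longrightarrow> v \<in> s03_functionals \<Longrightarrow> convolution S03_comult u v \<in> s03_functionals"

lemma clinear_s03_functionals: "u \<in> s03_functionals \<Longrightarrow> clinear u"
proof (induction rule: s03_functionals.induct)
  case (6 u v)
  note lin = 6(3,4)[THEN clinear_add] 6(3,4)[THEN clinear_scale]
  show ?case by (rule clinearI) (simp_all only: lin scaleC_add_right add_ac)
next
  case (7 u c)
  note lin = 7(2)[THEN clinear_add] 7(2)[THEN clinear_scale]
  show ?case by (rule clinearI) (simp_all add: lin algebra_simps)
next
  case (8 u v)
  then show ?case by (intro S03.clinear_convolution)
qed (simp_all add: functional_A_def functional_B_def functional_C_def functional_D_def
    clinear_S03_linear S03.clinear_counit del: scaleC_complex_def)

typedef s03 = s03_functionals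
  morphisms pairing Abs_s03
  using s03_functionals.intros(1) by blast

setup_lifting type_definition_s03

lemma clinear_pairing: "clinear (pairing u)"
  using pairing clinear_s03_functionals by blast

instantiation s03 :: complex_algebra
begin
lift_definition zero_s03 :: s03 is "\<lambda>f. 0"
  using s03_functionals.intros(7)[OF s03_functionals.intros(1), of 0] by simp
lift_definition one_s03 :: s03 is S03_counit by (rule s03_functionals.intros)
lift_definition plus_s03 :: "s03 \<Rightarrow> s03 \<Rightarrow> s03" is "\<lambda>u v f. u f + v f" by (rule s03_functionals.intros)
lift_definition minus_s03 :: "s03 \<Rightarrow> s03 \<Rightarrow> s03" is "\<lambda>u v f. u f - v f"
proof -
  show "(\<lambda>f. u f - v f) \<in> s03_functionals" if "u \<in> s03_functionals" "v \<in> s03_functionals" for u v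
    using s03_functionals.intros(6)[OF that(1) s03_functionals.intros(7)[OF that(2), of "-1"]] by simp
qed
lift_definition uminus_s03 :: "s03 \<Rightarrow> s03" is "\<lambda>u f. - u f"
proof -
  show "(\<lambda>f. - u f) \<in> s03_functionals" if "u \<in> s03_functionals" for u
    using s03_functionals.intros(7)[OF that, of "-1"] by simp
qed
lift_definition scaleC_s03 :: "complex \<Rightarrow> s03 \<Rightarrow> s03" is "\<lambda>c u f. c * u f" by (rule s03_functionals.intros)
lift_definition times_s03 :: "s03 \<Rightarrow> s03 \<Rightarrow> s03" is "convolution S03_comult" by (rule s03_functionals.intros)
instance
  by standard (transfer; simp add: fun_eq_iff algebra_simps
      S03.convolution_assoc[THEN fun_cong] S03.convolution_unit[THEN fun_cong]
      S03.convolution_add[THEN fun_cong] S03.convolution_scale[THEN fun_cong] clinear_s03_functionals)+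
end

lift_definition s03_A :: s03 is functional_A by (rule s03_functionals.intros)
lift_definition s03_B :: s03 is functional_B by (rule s03_functionals.intros)
lift_definition s03_C :: s03 is functional_C by (rule s03_functionals.intros)
lift_definition s03_D :: s03 is functional_D by (rule s03_functionals.intros)

text \<open>The pairing of \<open>s03 \<otimes> s03\<close> with \<open>S03 \<otimes> S03\<close> determined by
  \<open>\<langle>u \<otimes> v, f \<otimes> g\<rangle> = \<langle>u, f\<rangle> \<langle>v, g\<rangle>\<close>.\<close>

definition tensor_pairing :: "(s03, s03) tensor \<Rightarrow> (S03, S03) tensor \<Rightarrow> complex"
  where "tensor_pairing T t = tensor_lift (\<lambda>u v. tensor_lift (\<lambda>f g. pairing u f * pairing v g) t) T"

text \<open>The description below determines the coproduct only if such a \<open>T\<close> exists and is unique for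
  every \<open>u\<close>; this is not proved here.\<close>

definition s03_comult :: "s03 \<Rightarrow> (s03, s03) tensor"
  where "s03_comult u = (THE T. \<forall>f g. pairing u (f * g) = tensor_pairing T (f \<otimes> g))"

definition s03_counit :: "s03 \<Rightarrow> complex"
  where "s03_counit u = pairing u 1"

end

theory Submission
  imports Defs
begin

text \<open>Only left translates matter: a functional \<open>u\<close> on \<open>S03\<close> is determined by \<open>\<langle>u, 1\<rangle>\<close> and the four
  functionals \<open>f \<mapsto> \<langle>u, x f\<rangle>\<close> for \<open>x\<close> a generator. The translates of \<open>A\<close>, \<open>B\<close>, \<open>C\<close>, \<open>D\<close> lie again in \<open>s03\<close>,
  and those of a product follow from the coproduct of the generators, so every relation is checked
  by comparing translates. The element \<open>E = 1 - B\<^sup>2\<close> reads off the coefficient of the empty word.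
  The coproduct exists on the four generators by induction on words and on products because the
  coproduct of \<open>S03\<close> is multiplicative; it is unique because the pairing of tensors is nondegenerate.
  As it is an algebra homomorphism, the bialgebra axioms need checking only on generators.\<close>

section \<open>Finite sums of pure tensors\<close>

text \<open>A scalar multiple of a pure tensor is pure, as the scalar moves into the left factor,
  and \<open>0 = 0 \<otimes> 0\<close>. So every tensor is a finite sum of pure ones and two cases
  suffice.\<close>

lemma tensor_induct [case_names pure add]:
  assumes pure: "\<And>x y. P (x \<otimes> y)" and add: "\<And>s t. P s \<Longrightarrow> P t \<Longrightarrow> P (s + t)"
  shows "P t"
proof -
  obtain p where t: "t = abs_tensor p" using abs_tensor_surj by blast
  have zero: "P 0" using pure[of 0 0] by simp
  have scaled: "P (c *\<^sub>C abs_tensor (Poly_Mapping.single k 1))" for c k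
  proof -
    have "abs_tensor (Poly_Mapping.single k 1) = fst k \<otimes> snd k" by (simp add: pure_tensor.abs_eq)
    then show ?thesis using pure[of "c *\<^sub>C fst k" "snd k"] by (simp only: pure_tensor_simps(2))
  qed
  have "P (\<Sum>k\<in>K. c k *\<^sub>C abs_tensor (Poly_Mapping.single k 1))" for K and c :: "'a \<times> 'b \<Rightarrow> complex"
    by (induction K rule: infinite_finite_induct) (simp_all add: zero add scaled del: scaleC_single)
  moreover have "t = (\<Sum>k\<in>Poly_Mapping.keys p. Poly_Mapping.lookup p k *\<^sub>C abs_tensor (Poly_Mapping.single k 1))"
    using arg_cong[OF poly_mapping_sum_single[of p], of abs_tensor]
    by (simp add: t clinear_sum[OF clinear_abs_tensor] clinear_scale[OF clinear_abs_tensor] del: scaleC_single)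
  ultimately show ?thesis by simp
qed

text \<open>All right factors are expanded in one basis \<open>V\<close> of the second space. As
  \<open>V\<close> is fixed beforehand, expansions of two tensors merge into one with right factors
  in \<open>V\<close>.\<close>

lemma tensor_sum_independent:
  fixes t :: "('a::complex_vector, 'b::complex_vector) tensor"
  obtains F c where "finite F" "cvec.independent F" "t = (\<Sum>b\<in>F. c b \<otimes> b)"
proof -
  define V where "V = cvec.extend_basis ({} :: 'b set)"
  have V: "cvec.independent V" "cvec.span V = UNIV"
    unfolding V_def by (auto simp: cvec.independent_empty cvec.independent_extend_basis cvec.span_extend_basis)
  have "\<exists>F c. finite F \<and> F \<subseteq> V \<and> t = (\<Sum>b\<in>F. c b \<otimes> b)"
  proof (induction t rule: tensor_induct)
    case (pure x y)
    let ?r = "cvec.representation V y"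
    let ?F = "{b. ?r b \<noteq> 0}"
    have "x \<otimes> y = x \<otimes> (\<Sum>b\<in>?F. ?r b *\<^sub>C b)"
      using cvec.sum_nonzero_representation_eq[OF V(1), of y] by (simp only: V(2) UNIV_I)
    also have "\<dots> = (\<Sum>b\<in>?F. (?r b *\<^sub>C x) \<otimes> b)"
    proof -
      have lin: "clinear (\<lambda>y::'b. x \<otimes> y)" by (rule clinearI) (simp_all only: pure_tensor_simps)
      show ?thesis unfolding clinear_sum[OF lin] pure_tensor_simps ..
    qed
    finally have "x \<otimes> y = (\<Sum>b\<in>?F. (?r b *\<^sub>C x) \<otimes> b)" .
    moreover have "finite ?F" by (rule cvec.finite_representation)
    moreover have "?F \<subseteq> V" using cvec.representation_ne_zero by blast
    ultimately show ?case by (intro exI[of _ ?F] exI[of _ "\<lambda>b. ?r b *\<^sub>C x"] conjI)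
  next
    case (add s t)
    then obtain F c F' c' where
      s: "finite F" "F \<subseteq> V" "s = (\<Sum>b\<in>F. c b \<otimes> b)" and
      t: "finite F'" "F' \<subseteq> V" "t = (\<Sum>b\<in>F'. c' b \<otimes> b)" by blast
    \<comment> \<open>The coefficients are arbitrary off their own index set; setting them to zero
      there lets both sums run over \<open>F \<union> F'\<close>.\<close>
    define d where "d b = (if b \<in> F then c b else 0)" for b
    define d' where "d' b = (if b \<in> F' then c' b else 0)" for b
    have "s = (\<Sum>b\<in>F \<union> F'. d b \<otimes> b)" "t = (\<Sum>b\<in>F \<union> F'. d' b \<otimes> b)"
      unfolding s(3) t(3) using s(1) t(1)
      by (auto intro!: sum.mono_neutral_cong_left simp: d_def d'_def)
    then have "s + t = (\<Sum>b\<in>F \<union> F'. (d b + d' b) \<otimes> b)"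
      by (simp add: pure_tensor_simps sum.distrib)
    with s t show ?case by (intro exI[of _ "F \<union> F'"] exI[of _ "\<lambda>b. d b + d' b"]) auto
  qed
  then obtain F c where F: "finite F" "F \<subseteq> V" "t = (\<Sum>b\<in>F. c b \<otimes> b)" by blast
  from F(1) cvec.independent_mono[OF V(1) F(2)] F(3) show thesis by (rule that)
qed

lemma tensor_lift_sum_pure:
  assumes "cbilinear h"
  shows "tensor_lift h (\<Sum>i\<in>I. x i \<otimes> y i) = (\<Sum>i\<in>I. h (x i) (y i))"
  by (simp add: clinear_sum[OF clinear_tensor_lift[OF assms]] tensor_lift_pure[OF assms])


section \<open>The pairing and left translates\<close>

lemma pairing_add: "pairing (u + v) f = pairing u f + pairing v f"
  and pairing_diff: "pairing (u - v) f = pairing u f - pairing v f"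
  and pairing_uminus: "pairing (- u) f = - pairing u f"
  and pairing_scale: "pairing (c *\<^sub>C u) f = c * pairing u f"
  and pairing_zero: "pairing 0 f = 0"
  and pairing_one: "pairing 1 f = S03_counit f"
  and pairing_times: "pairing (u * v) f = convolution S03_comult (pairing u) (pairing v) f"
  by (simp_all add: plus_s03.rep_eq minus_s03.rep_eq uminus_s03.rep_eq scaleC_s03.rep_eq
      zero_s03.rep_eq one_s03.rep_eq times_s03.rep_eq)

lemmas pairing_simps = pairing_add pairing_diff pairing_uminus pairing_scale pairing_zero

lemma clinear_pairing_left: "clinear (\<lambda>u. pairing u f)"
  by (rule clinearI) (simp_all add: pairing_simps)

lemma s03_eqI: "(\<And>f. pairing u f = pairing v f) \<Longrightarrow> u = v"
  by (metis ext pairing_inject)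

lemma s03_eqI_word:
  assumes "\<And>w. pairing u (S03_word w) = pairing v (S03_word w)"
  shows "u = v"
  by (rule s03_eqI, rule S03_clinear_ext[OF clinear_pairing clinear_pairing assms])

text \<open>Carries rule induction on \<open>s03_functionals\<close> over to the type, phrased with
  its algebra operations.\<close>

lemma s03_induct [case_names A B C D one add scale mult]:
  assumes "P s03_A" "P s03_B" "P s03_C" "P s03_D" "P 1"
    and add: "\<And>u v. P u \<Longrightarrow> P v \<Longrightarrow> P (u + v)"
    and scale: "\<And>c u. P u \<Longrightarrow> P (c *\<^sub>C u)"
    and mult: "\<And>u v. P u \<Longrightarrow> P v \<Longrightarrow> P (u * v)"
  shows "P u"
proof -
  have "\<exists>v. pairing v = f \<and> P v" if "f \<in> s03_functionals" for f
    using that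
  proof (induction rule: s03_functionals.induct)
    case (6 u v)
    then show ?case using add plus_s03.rep_eq by metis
  next
    case (7 u c)
    then show ?case using scale scaleC_s03.rep_eq by metis
  next
    case (8 u v)
    then show ?case using mult times_s03.rep_eq by metis
  qed (use assms s03_A.rep_eq s03_B.rep_eq s03_C.rep_eq s03_D.rep_eq one_s03.rep_eq in blast)+
  from this[OF pairing] show ?thesis by (metis pairing_inject)
qed

text \<open>A relation and not a function: that the translates of an element of s03 lie in s03 is a
  theorem, \<open>left_translates_exist\<close>.\<close>

definition left_translates :: "s03 \<Rightarrow> s03 \<Rightarrow> s03 \<Rightarrow> s03 \<Rightarrow> s03 \<Rightarrow> bool" where
  "left_translates u ua ub uc ud \<longleftrightarrow>
     (\<forall>f. pairing u (\<a> * f) = pairing ua f \<and> pairing u (\<b> * f) = pairing ub f \<and>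
          pairing u (\<c> * f) = pairing uc f \<and> pairing u (\<d> * f) = pairing ud f)"

lemma left_translatesD:
  assumes "left_translates u ua ub uc ud"
  shows "pairing u (\<a> * f) = pairing ua f" "pairing u (\<b> * f) = pairing ub f"
    "pairing u (\<c> * f) = pairing uc f" "pairing u (\<d> * f) = pairing ud f"
  using assms by (simp_all add: left_translates_def)

lemma left_translates_add:
  "left_translates u ua ub uc ud \<Longrightarrow> left_translates v va vb vc vd \<Longrightarrow>
    left_translates (u + v) (ua + va) (ub + vb) (uc + vc) (ud + vd)"
  by (simp add: left_translates_def pairing_simps)

lemma left_translates_diff:
  "left_translates u ua ub uc ud \<Longrightarrow> left_translates v va vb vc vd \<Longrightarrow>
    left_translates (u - v) (ua - va) (ub - vb) (uc - vc) (ud - vd)"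
  by (simp add: left_translates_def pairing_simps)

lemma left_translates_uminus:
  "left_translates u ua ub uc ud \<Longrightarrow> left_translates (- u) (- ua) (- ub) (- uc) (- ud)"
  by (simp add: left_translates_def pairing_simps)

lemma left_translates_scale:
  "left_translates u ua ub uc ud \<Longrightarrow>
    left_translates (k *\<^sub>C u) (k *\<^sub>C ua) (k *\<^sub>C ub) (k *\<^sub>C uc) (k *\<^sub>C ud)"
  by (simp add: left_translates_def pairing_simps)

text \<open>The translates multiply by the rule dual to the coproduct of the generators.\<close>

lemma left_translates_mult:
  assumes u: "left_translates u ua ub uc ud" and v: "left_translates v va vb vc vd"
  shows "left_translates (u * v)
    (ua * va + ub * vb - uc * vc + ud * vd) (ua * vb + ub * va - uc * vd + ud * vc)
    (ua * vc + uc * va - ub * vd + ud * vb) (ua * vd + ud * va - ub * vc + uc * vb)"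
proof -
  define L where "L u v = tensor_lift (\<lambda>x y. pairing u x * pairing v y)" for u v
  have bil: "cbilinear (\<lambda>x y. pairing u x * pairing v y)" for u v
    by (intro cbilinear_functionals clinear_pairing)
  note lin = clinear_tensor_lift[OF bil, folded L_def]
  have pure: "L u v (x \<otimes> y) = pairing u x * pairing v y" for u v x y
    unfolding L_def by (rule tensor_lift_pure[OF bil])
  have L: "pairing (u * v) f = L u v (S03_comult f)" for u v f
    by (simp add: pairing_times convolution_def L_def)
  \<comment> \<open>A pure left factor translates the two functionals separately; by linearity only
    pure \<open>t\<close> need checking. Below, one instance serves each pair of generators.\<close>
  have shift: "L u v ((x \<otimes> y) * t) = L u' v' t"
    if "\<And>f. pairing u (x * f) = pairing u' f" "\<And>f. pairing v (y * f) = pairing v' f"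
    for x y t u v u' v'
    by (rule tensor_ext[where f = "\<lambda>t. L u v ((x \<otimes> y) * t)"])
       (rule clinear_compose[OF lin clinear_mult(1)] lin | simp add: pure_tensor_mult pure that)+
  have gen: "S03_comult (S03_gen x * f) = S03_comult_gen x * S03_comult f" for x f
    using S03_comult_hom by (simp add: algebra_hom_def S03_comult_gen)
  note s = u[THEN left_translatesD(1)] u[THEN left_translatesD(2)]
    u[THEN left_translatesD(3)] u[THEN left_translatesD(4)]
    v[THEN left_translatesD(1)] v[THEN left_translatesD(2)]
    v[THEN left_translatesD(3)] v[THEN left_translatesD(4)]
  show ?thesis
    unfolding left_translates_def
    by (simp add: L gen pairing_add pairing_diff distrib_right left_diff_distrib
        clinear_add[OF lin] clinear_diff[OF lin] shift[OF s(1) s(5)] shift[OF s(1) s(6)]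
        shift[OF s(1) s(7)] shift[OF s(1) s(8)] shift[OF s(2) s(5)] shift[OF s(2) s(6)]
        shift[OF s(2) s(7)] shift[OF s(2) s(8)] shift[OF s(3) s(5)] shift[OF s(3) s(6)]
        shift[OF s(3) s(7)] shift[OF s(3) s(8)] shift[OF s(4) s(5)] shift[OF s(4) s(6)]
        shift[OF s(4) s(7)] shift[OF s(4) s(8)])
qed

lemma S03_word_induct:
  assumes "P 1" "\<And>w. P (S03_word w) \<Longrightarrow> P (\<a> * S03_word w)" "\<And>w. P (S03_word w) \<Longrightarrow> P (\<b> * S03_word w)"
    "\<And>w. P (S03_word w) \<Longrightarrow> P (\<c> * S03_word w)" "\<And>w. P (S03_word w) \<Longrightarrow> P (\<d> * S03_word w)"
  shows "P (S03_word w)"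
proof (induction w)
  case Nil
  then show ?case using assms(1) by (simp add: S03_word_Nil)
next
  case (Cons x w)
  then show ?case unfolding S03_word_Cons[of x w] by (cases x) (simp_all add: assms)
qed

text \<open>On a nonempty word \<open>x # v\<close> both functionals take the value of their common
  translate at \<open>v\<close>; the value at 1 settles the empty word.\<close>

lemma s03_eqI_translates:
  assumes "left_translates u ua ub uc ud" "left_translates v ua ub uc ud" "pairing u 1 = pairing v 1"
  shows "u = v"
proof (rule s03_eqI_word)
  show "pairing u (S03_word w) = pairing v (S03_word w)" for w
    by (induction w rule: S03_word_induct)
       (simp_all add: assms(3) assms(1,2)[THEN left_translatesD(1)] assms(1,2)[THEN left_translatesD(2)]
         assms(1,2)[THEN left_translatesD(3)] assms(1,2)[THEN left_translatesD(4)])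
qed

text \<open>Leading letters a can be stripped without changing the value; then another letter gives
  0, or the empty word is reached. This serves combinations that reproduce themselves under
  translation by a.\<close>

lemma s03_eq_0I_translates:
  assumes "left_translates u u 0 0 0" "pairing u 1 = 0"
  shows "u = 0"
proof (rule s03_eqI_word)
  show "pairing u (S03_word w) = pairing 0 (S03_word w)" for w
    by (induction w rule: S03_word_induct)
       (simp_all add: pairing_zero assms(2) left_translatesD[OF assms(1)])
qed

lemma pairing_mult_at_1: "pairing (u * v) 1 = pairing u 1 * pairing v 1"
proof -
  have "S03_comult 1 = 1 \<otimes> 1" using S03_comult_hom by (simp add: algebra_hom_def one_tensor_def)
  then show ?thesis
    by (simp add: pairing_times convolution_def
        tensor_lift_pure[OF cbilinear_functionals[OF clinear_pairing clinear_pairing]])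
qed

lemma pairing_one_mult: "pairing 1 (f * g) = pairing 1 f * pairing 1 g"
  and pairing_one_at_1: "pairing 1 1 = 1"
  using S03_counit_hom by (simp_all add: pairing_one algebra_hom_def)


section \<open>Translates of the generators\<close>

lemma basis_word_Nil: "basis_word []"
  by (simp add: basis_word_def)

lemma basis_word_Cons:
  "basis_word (x # w) \<longleftrightarrow> basis_word w \<and> (\<forall>y v. w = y # v \<longrightarrow> (x, y) \<notin> forbidden)"
  unfolding basis_word_def by (auto simp: Cons_eq_append_conv) (metis append_Cons)+

lemma basis_word_replicate_a: "basis_word (replicate k Gen_a)"
proof (induction k)
  case (Suc k)
  then show ?case by (cases k) (auto simp: basis_word_Cons forbidden_def)
qed (simp add: basis_word_Nil)

lemma basis_word_b_replicate_a: "basis_word (Gen_b # replicate k Gen_a)"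
  using basis_word_replicate_a[of k] by (cases k) (auto simp: basis_word_Cons forbidden_def)

lemma basis_word_replicate_a_c: "basis_word (replicate k Gen_a @ [Gen_c])"
proof (induction k)
  case (Suc k)
  then show ?case by (cases k) (auto simp: basis_word_Cons forbidden_def)
qed (simp add: basis_word_Nil basis_word_Cons)

text \<open>Words with a forbidden pair are zero in S03, so a prescription vanishing on them is
  valid on all words and later inductions need no side condition.\<close>

lemma S03_linear_word_all:
  assumes "\<not> basis_word w \<Longrightarrow> \<phi> w = 0"
  shows "S03_linear \<phi> (S03_word w) = \<phi> w"
  using assms
  by (cases "basis_word w") (simp_all add: S03_linear_word S03_word_eq_0 clinear_0[OF clinear_S03_linear])

lemma pairing_A_word:
  "pairing s03_A (S03_word w) = (if w = replicate (length w) Gen_a then of_nat (length w) else 0)"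
  unfolding s03_A.rep_eq functional_A_def
  by (rule S03_linear_word_all) (metis basis_word_replicate_a)

lemma pairing_B_word:
  "pairing s03_B (S03_word w) = (if \<exists>k. w = Gen_b # replicate k Gen_a then 1 else 0)"
  unfolding s03_B.rep_eq functional_B_def
  by (rule S03_linear_word_all) (auto simp: basis_word_b_replicate_a)

lemma pairing_C_word:
  "pairing s03_C (S03_word w) = (if \<exists>k. w = replicate k Gen_a @ [Gen_c] then 1 else 0)"
  unfolding s03_C.rep_eq functional_C_def
  by (rule S03_linear_word_all) (auto simp: basis_word_replicate_a_c)

lemma pairing_D_word: "pairing s03_D (S03_word w) = (if w = [Gen_d] then 1 else 0)"
  unfolding s03_D.rep_eq functional_D_def
  by (rule S03_linear_word_all) (auto simp: basis_word_Nil basis_word_Cons)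

lemma left_translates_one: "left_translates 1 1 0 0 0"
  using S03_counit_hom
  by (simp add: left_translates_def pairing_one pairing_zero algebra_hom_def S03_counit_gen)

lemma pairing_one_word: "pairing 1 (S03_word w) = (if w = replicate (length w) Gen_a then 1 else 0)"
proof (induction w)
  case Nil
  then show ?case by (simp add: S03_word_Nil pairing_one_at_1)
next
  case (Cons x w)
  then show ?case
    unfolding S03_word_Cons[of x w]
    by (cases x) (simp_all add: left_translatesD[OF left_translates_one] pairing_zero)
qed

lemma left_translatesI:
  assumes "\<And>w. pairing u (S03_word (Gen_a # w)) = pairing ua (S03_word w)"
    "\<And>w. pairing u (S03_word (Gen_b # w)) = pairing ub (S03_word w)"
    "\<And>w. pairing u (S03_word (Gen_c # w)) = pairing uc (S03_word w)"
    "\<And>w. pairing u (S03_word (Gen_d # w)) = pairing ud (S03_word w)"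
  shows "left_translates u ua ub uc ud"
proof -
  have ext: "pairing u (S03_gen x * f) = pairing v f"
    if "\<And>w. pairing u (S03_word (x # w)) = pairing v (S03_word w)" for x v f
  proof (rule S03_clinear_ext[where f = "\<lambda>f. pairing u (S03_gen x * f)"])
    show "clinear (\<lambda>f. pairing u (S03_gen x * f))"
      by (rule clinear_compose[OF clinear_pairing clinear_mult(1)])
    show "pairing u (S03_gen x * S03_word w) = pairing v (S03_word w)" for w
      using that[of w] unfolding S03_word_Cons[of x w] .
  qed (rule clinear_pairing)
  show ?thesis unfolding left_translates_def by (intro allI conjI ext assms)
qed

text \<open>One more letter a raises the exponent by one; the counit supplies this increment, being
  1 on powers of a and 0 on all other words.\<close>

lemma left_translates_A: "left_translates s03_A (s03_A + 1) 0 0 0"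
  by (rule left_translatesI) (simp_all add: pairing_A_word pairing_simps pairing_one_word)

text \<open>After the leading b the rest must be a power of a, and the counit is the indicator of
  these powers.\<close>

lemma left_translates_B: "left_translates s03_B 0 1 0 0"
proof (rule left_translatesI)
  have *: "(\<exists>k. w = replicate k Gen_a) \<longleftrightarrow> w = replicate (length w) Gen_a" for w
    by (metis length_replicate)
  show "pairing s03_B (S03_word (Gen_b # w)) = pairing 1 (S03_word w)" for w
    using * by (simp add: pairing_B_word pairing_one_word)
qed (simp_all add: pairing_B_word pairing_zero)

text \<open>The functional that reads off the coefficient of the empty word.\<close>

definition s03_E :: s03 where "s03_E = 1 - s03_B ^ 2"

lemma pairing_generators_at_1: "pairing s03_A 1 = 0" "pairing s03_B 1 = 0" "pairing s03_C 1 = 0" "pairing s03_D 1 = 0"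
  unfolding S03_word_Nil[symmetric]
  by (simp_all add: pairing_A_word pairing_B_word pairing_C_word pairing_D_word)

text \<open>By the product rule \<open>s03_B ^ 2\<close> has the same translates as
  \<open>1\<close>, so they cancel in the difference.\<close>

lemma left_translates_E: "left_translates s03_E 0 0 0 0"
  using left_translates_diff[OF left_translates_one left_translates_mult[OF left_translates_B left_translates_B]]
  by (simp add: s03_E_def power2_eq_square)

lemma pairing_E_at_1: "pairing s03_E 1 = 1"
  by (simp add: s03_E_def power2_eq_square pairing_simps pairing_mult_at_1 pairing_generators_at_1 pairing_one_at_1)

lemma pairing_E_word: "pairing s03_E (S03_word w) = (if w = [] then 1 else 0)"
proof (cases w)
  case Nil
  then show ?thesis by (simp add: S03_word_Nil pairing_E_at_1)
next
  case (Cons x v)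
  then show ?thesis
    unfolding S03_word_Cons[of x v] Cons
    by (cases x) (simp_all add: left_translatesD[OF left_translates_E] pairing_zero)
qed

text \<open>Removing a leading a from a word counted by \<open>s03_C\<close> leaves such a word; a
  leading c must be the last letter, so \<open>s03_E\<close> tests that nothing follows.\<close>

lemma left_translates_C: "left_translates s03_C s03_C 0 s03_E 0"
proof (rule left_translatesI)
  show "pairing s03_C (S03_word (Gen_a # w)) = pairing s03_C (S03_word w)" for w
  proof -
    have "(\<exists>k. Gen_a # w = replicate k Gen_a @ [Gen_c]) \<longleftrightarrow> (\<exists>k. w = replicate k Gen_a @ [Gen_c])"
    proof safe
      fix k assume "Gen_a # w = replicate k Gen_a @ [Gen_c]"
      then show "\<exists>k. w = replicate k Gen_a @ [Gen_c]" by (cases k) auto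
    next
      fix k show "\<exists>l. Gen_a # replicate k Gen_a @ [Gen_c] = replicate l Gen_a @ [Gen_c]"
        by (rule exI[of _ "Suc k"]) simp
    qed
    then show ?thesis by (simp add: pairing_C_word)
  qed
qed (auto simp: pairing_C_word pairing_zero pairing_E_word Cons_eq_append_conv Cons_replicate_eq)

lemma left_translates_D: "left_translates s03_D 0 0 0 s03_E"
  by (rule left_translatesI) (simp_all add: pairing_D_word pairing_zero pairing_E_word)


section \<open>Relations in s03\<close>

text \<open>Without translates a functional vanishes on all nonempty words, so its value at 1
  determines it.\<close>

lemma eq_scale_E_if_left_translates_0:
  assumes "left_translates u 0 0 0 0"
  shows "u = pairing u 1 *\<^sub>C s03_E"
  using s03_eqI_translates[OF assms left_translates_scale[OF left_translates_E, of "pairing u 1", simplified]]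
  by (simp add: pairing_scale pairing_E_at_1)

lemma left_translates_exist: "\<exists>ua ub uc ud. left_translates u ua ub uc ud"
proof (induction u rule: s03_induct)
  case A show ?case using left_translates_A by blast
next
  case B show ?case using left_translates_B by blast
next
  case C show ?case using left_translates_C by blast
next
  case D show ?case using left_translates_D by blast
next
  case one show ?case using left_translates_one by blast
next
  case (add u v) then show ?case using left_translates_add by blast
next
  case (scale c u) then show ?case using left_translates_scale by blast
next
  case (mult u v) then show ?case using left_translates_mult by blast
qed

text \<open>Each term of the product rule contains a translate of \<open>s03_E\<close>, which is 0,
  so the product is a multiple of \<open>s03_E\<close>. Thus \<open>s03_E\<close> is a two-sided
  integral; in particular it annihilates the four generators.\<close>

lemma E_mult: "s03_E * u = pairing u 1 *\<^sub>C s03_E"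
  and mult_E: "u * s03_E = pairing u 1 *\<^sub>C s03_E"
proof -
  obtain ua ub uc ud where u: "left_translates u ua ub uc ud" using left_translates_exist by blast
  show "s03_E * u = pairing u 1 *\<^sub>C s03_E"
    using eq_scale_E_if_left_translates_0[of "s03_E * u"] left_translates_mult[OF left_translates_E u]
    by (simp add: pairing_mult_at_1 pairing_E_at_1)
  show "u * s03_E = pairing u 1 *\<^sub>C s03_E"
    using eq_scale_E_if_left_translates_0[of "u * s03_E"] left_translates_mult[OF u left_translates_E]
    by (simp add: pairing_mult_at_1 pairing_E_at_1)
qed

lemma E_mult_generators:
  "s03_E * s03_A = 0" "s03_E * s03_B = 0" "s03_E * s03_C = 0" "s03_E * s03_D = 0"
  "s03_A * s03_E = 0" "s03_B * s03_E = 0" "s03_C * s03_E = 0" "s03_D * s03_E = 0"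
  "s03_E * s03_E = s03_E"
  by (simp_all add: E_mult mult_E pairing_generators_at_1 pairing_E_at_1 scaleC_one)

lemma B_square: "s03_B ^ 2 = 1 - s03_E"
  by (simp add: s03_E_def)

lemma B_square_mult:
  "s03_B ^ 2 * s03_A = s03_A" "s03_B ^ 2 * s03_B = s03_B" "s03_B ^ 2 * s03_C = s03_C"
  "s03_B ^ 2 * s03_D = s03_D" "s03_D * s03_B ^ 2 = s03_D"
  by (simp_all add: B_square left_diff_distrib right_diff_distrib E_mult_generators)

lemmas at_1_simps = pairing_simps pairing_mult_at_1 pairing_generators_at_1

text \<open>The a-translate is \<open>1 + (s03_C ^ 2 - s03_E)\<close>, which is the sum itself
  because \<open>1 - s03_E = s03_B ^ 2\<close>.\<close>

lemma B_square_plus_C_square: "s03_B ^ 2 + s03_C ^ 2 = 0"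
proof (rule s03_eq_0I_translates)
  show "left_translates (s03_B ^ 2 + s03_C ^ 2) (s03_B ^ 2 + s03_C ^ 2) 0 0 0"
    using left_translates_add[OF left_translates_mult[OF left_translates_B left_translates_B]
        left_translates_mult[OF left_translates_C left_translates_C]]
    by (simp add: E_mult_generators B_square[unfolded power2_eq_square] power2_eq_square algebra_simps)
qed (simp add: power2_eq_square at_1_simps)

lemma A_B_commute: "s03_A * s03_B = s03_B * s03_A"
  using left_translates_mult[OF left_translates_A left_translates_B]
    left_translates_mult[OF left_translates_B left_translates_A]
  by (intro s03_eqI_translates[where ua = 0 and ub = "s03_A + 1" and uc = 0 and ud = 0])
     (simp_all add: at_1_simps)

text \<open>Both products have c-translate \<open>s03_E\<close>, and the extra \<open>s03_C\<close>
  in their a-translates cancels, so the commutator is its own a-translate.\<close>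

lemma A_C_commute: "s03_A * s03_C = s03_C * s03_A"
proof -
  have "s03_A * s03_C - s03_C * s03_A = 0"
  proof (rule s03_eq_0I_translates)
    show "left_translates (s03_A * s03_C - s03_C * s03_A) (s03_A * s03_C - s03_C * s03_A) 0 0 0"
      using left_translates_diff[OF left_translates_mult[OF left_translates_A left_translates_C]
          left_translates_mult[OF left_translates_C left_translates_A]]
      by (simp add: algebra_simps E_mult_generators)
  qed (simp add: at_1_simps)
  then show ?thesis by simp
qed

lemma A_mult_D: "s03_A * s03_D = s03_D"
  using left_translates_mult[OF left_translates_A left_translates_D]
  by (intro s03_eqI_translates[OF _ left_translates_D])
     (simp_all add: algebra_simps E_mult_generators at_1_simps)

lemma D_mult_A: "s03_D * s03_A = s03_D"
  using left_translates_mult[OF left_translates_D left_translates_A]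
  by (intro s03_eqI_translates[OF _ left_translates_D])
     (simp_all add: algebra_simps E_mult_generators at_1_simps)

text \<open>So \<open>s03_D ^ 2\<close> reads off the coefficient of the word a.\<close>

lemma left_translates_D_square: "left_translates (s03_D ^ 2) s03_E 0 0 0"
  using left_translates_mult[OF left_translates_D left_translates_D]
  by (simp add: E_mult_generators power2_eq_square)

lemma D_cube: "s03_D ^ 3 = s03_D"
proof -
  have "s03_D * s03_D ^ 2 = s03_D"
    using left_translates_mult[OF left_translates_D left_translates_D_square]
    by (intro s03_eqI_translates[OF _ left_translates_D]) (simp_all add: E_mult_generators at_1_simps)
  then show ?thesis by (simp add: power3_eq_cube power2_eq_square mult.assoc)
qed

text \<open>Both products have b-translate \<open>s03_C\<close>, which cancels; their d-translates
  are \<open>- s03_E\<close> and \<open>s03_E\<close>, whence the factor -2.\<close>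

lemma B_C_commutator: "commutator s03_B s03_C = (-2) *\<^sub>C s03_D"
proof (rule s03_eqI_translates)
  show "left_translates (commutator s03_B s03_C) 0 0 0 ((-2) *\<^sub>C s03_E)"
  proof -
    have "(-2) *\<^sub>C s03_E = - s03_E - s03_E"
      using scaleC_add_left[of "-1" "-1" s03_E] by (simp add: scaleC_one)
    then show ?thesis
      using left_translates_diff[OF left_translates_mult[OF left_translates_B left_translates_C]
          left_translates_mult[OF left_translates_C left_translates_B]] by simp
  qed
  show "left_translates ((-2) *\<^sub>C s03_D) 0 0 0 ((-2) *\<^sub>C s03_E)"
    using left_translates_scale[OF left_translates_D, of "-2"] by simp
qed (simp add: at_1_simps)

lemma left_translates_D_mult_B: "left_translates (s03_D * s03_B) 0 0 s03_E 0"
  using left_translates_mult[OF left_translates_D left_translates_B] by simp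

text \<open>All the expressions read off the coefficient of the word c.\<close>

lemma D_mult_B:
  "s03_D * s03_B = - (s03_B * s03_D)" "s03_D * s03_B = s03_C * s03_D ^ 2" "s03_D * s03_B = s03_D ^ 2 * s03_C"
  using left_translates_uminus[OF left_translates_mult[OF left_translates_B left_translates_D]]
    left_translates_mult[OF left_translates_C left_translates_D_square]
    left_translates_mult[OF left_translates_D_square left_translates_C]
  by (intro s03_eqI_translates[OF left_translates_D_mult_B]; simp add: at_1_simps E_mult_generators)+

text \<open>The b-translates \<open>- s03_E\<close> and \<open>s03_E\<close> of the two products
  cancel.\<close>

lemma C_D_anticommute: "s03_C * s03_D + s03_D * s03_C = 0"
proof (rule s03_eqI_translates)
  show "left_translates (s03_C * s03_D + s03_D * s03_C) 0 0 0 0"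
    using left_translates_add[OF left_translates_mult[OF left_translates_C left_translates_D]
        left_translates_mult[OF left_translates_D left_translates_C]]
    by (simp add: E_mult_generators)
  show "left_translates 0 0 0 0 0"
    by (simp add: left_translates_def pairing_zero)
qed (simp add: at_1_simps)

section \<open>Central elements\<close>

lemma center_s03I:
  assumes "z * s03_A = s03_A * z" "z * s03_B = s03_B * z" "z * s03_C = s03_C * z" "z * s03_D = s03_D * z"
  shows "z \<in> center"
proof -
  have "z * x = x * z" for x
  proof (induction x rule: s03_induct)
    case (mult u v)
    then show ?case by (metis mult.assoc)
  qed (simp_all add: assms algebra_simps mult_scaleC_left mult_scaleC_right)
  then show ?thesis by (simp add: center_def)
qed

lemma A_central: "s03_A \<in> center"
  by (rule center_s03I) (simp_all add: A_B_commute A_C_commute A_mult_D D_mult_A)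

lemma B_square_central: "s03_B ^ 2 \<in> center"
  by (rule center_s03I) (simp_all add: B_square algebra_simps E_mult_generators)

lemma D_square_central: "s03_D ^ 2 \<in> center"
proof (rule center_s03I)
  show "s03_D ^ 2 * s03_A = s03_A * s03_D ^ 2"
    unfolding power2_eq_square by (metis mult.assoc A_mult_D D_mult_A)
  \<comment> \<open>Moving \<open>s03_B\<close> past the two factors \<open>s03_D\<close> changes
    the sign twice.\<close>
  show "s03_D ^ 2 * s03_B = s03_B * s03_D ^ 2"
    unfolding power2_eq_square by (metis mult.assoc D_mult_B(1) mult_minus_left mult_minus_right minus_minus)
  show "s03_D ^ 2 * s03_C = s03_C * s03_D ^ 2"
    using D_mult_B(2,3) by simp
  show "s03_D ^ 2 * s03_D = s03_D * s03_D ^ 2"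
    by (simp add: power2_eq_square mult.assoc)
qed


section \<open>The coproduct of s03\<close>

lemma tensor_pairing_pure_right:
  "tensor_pairing T (f \<otimes> g) = tensor_lift (\<lambda>u v. pairing u f * pairing v g) T"
  by (simp add: tensor_pairing_def tensor_lift_pure[OF cbilinear_functionals[OF clinear_pairing clinear_pairing]])

lemma cbilinear_pairings: "cbilinear (\<lambda>u v. pairing u f * pairing v g)"
  by (intro cbilinear_functionals clinear_pairing_left)

lemma clinear_tensor_pairing: "clinear (\<lambda>T. tensor_pairing T (f \<otimes> g))"
  unfolding tensor_pairing_pure_right by (rule clinear_tensor_lift[OF cbilinear_pairings])

lemma tensor_pairing_pure: "tensor_pairing (u \<otimes> v) (f \<otimes> g) = pairing u f * pairing v g"
  unfolding tensor_pairing_pure_right by (rule tensor_lift_pure[OF cbilinear_pairings])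

lemmas tensor_pairing_simps = clinear_add[OF clinear_tensor_pairing] clinear_diff[OF clinear_tensor_pairing]
  clinear_scale[OF clinear_tensor_pairing] tensor_pairing_pure

text \<open>Writing \<open>T\<close> with linearly independent right factors reduces nondegeneracy of the pairing on
  \<open>s03 \<otimes> s03\<close> to that of its factors.\<close>

lemma tensor_pairing_nondegenerate:
  assumes "\<And>f g. tensor_pairing T (f \<otimes> g) = 0"
  shows "T = 0"
proof -
  obtain F c where F: "finite F" "cvec.independent F" and T: "T = (\<Sum>b\<in>F. c b \<otimes> b)"
    by (rule tensor_sum_independent)
  have "pairing (c b) f = 0" if b: "b \<in> F" for b f
  proof -
    \<comment> \<open>With \<open>f\<close> fixed and \<open>g\<close> varying, the hypothesis says
      that a linear combination of the independent \<open>b\<close> is zero.\<close>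
    have "pairing (\<Sum>b\<in>F. pairing (c b) f *\<^sub>C b) g = 0" for g
      using assms[of f g]
      by (simp add: T clinear_sum[OF clinear_tensor_pairing] clinear_sum[OF clinear_pairing_left]
          pairing_scale tensor_pairing_pure)
    then have "(\<Sum>b\<in>F. pairing (c b) f *\<^sub>C b) = 0"
      by (intro s03_eqI) (simp add: pairing_zero)
    from cvec.independentD[OF F(2,1) subset_refl this b] show ?thesis .
  qed
  then have "c b = 0" if "b \<in> F" for b
    using that by (intro s03_eqI) (simp add: pairing_zero)
  then show ?thesis by (simp add: T)
qed

text \<open>As the coproduct of S03 is multiplicative, \<open>u * v\<close> at \<open>f * g\<close>
  is a sum of values of \<open>u\<close> and \<open>v\<close> at products of the parts of
  \<open>f\<close> and \<open>g\<close>. This shows that coproducts of \<open>u\<close> and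
  \<open>v\<close> multiply to one of \<open>u * v\<close>.\<close>

lemma tensor_pairing_mult:
  assumes u: "\<And>f g. pairing u (f * g) = tensor_pairing S (f \<otimes> g)"
    and v: "\<And>f g. pairing v (f * g) = tensor_pairing T (f \<otimes> g)"
  shows "pairing (u * v) (f * g) = tensor_pairing (S * T) (f \<otimes> g)"
proof -
  obtain I x where f: "S03_comult f = (\<Sum>y\<in>I. x y \<otimes> y)" by (rule tensor_sum_independent)
  obtain J x' where g: "S03_comult g = (\<Sum>z\<in>J. x' z \<otimes> z)" by (rule tensor_sum_independent)
  note sum_pure = tensor_lift_sum_pure[OF cbilinear_functionals[OF clinear_pairing clinear_pairing]]
  have fg: "S03_comult (f * g) = (\<Sum>(y, z)\<in>I \<times> J. (x y * x' z) \<otimes> (y * z))"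
    using S03_comult_hom
    by (simp add: algebra_hom_def f g sum_product pure_tensor_mult sum.cartesian_product)
  \<comment> \<open>Letting \<open>S\<close> and \<open>T\<close> vary makes the sum bilinear in
    them, which reduces the identity to pure tensors.\<close>
  define G where "G S T = (\<Sum>y\<in>I. \<Sum>z\<in>J. tensor_pairing S (x y \<otimes> x' z) * tensor_pairing T (y \<otimes> z))" for S T
  have "pairing (u * v) (f * g) = G S T"
    by (simp add: pairing_times convolution_def fg sum_pure u v G_def case_prod_beta sum.cartesian_product)
  also have "\<dots> = tensor_pairing (S * T) (f \<otimes> g)"
  proof (rule tensor_ext[where f = "\<lambda>S. G S T"])
    show "clinear (\<lambda>S. G S T)"
      by (rule clinearI) (simp_all add: G_def tensor_pairing_simps distrib_right sum.distrib sum_distrib_left mult.assoc)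
    show "clinear (\<lambda>S. tensor_pairing (S * T) (f \<otimes> g))"
      by (rule clinear_compose[OF clinear_tensor_pairing clinear_mult(2)])
    fix p q
    show "G (p \<otimes> q) T = tensor_pairing ((p \<otimes> q) * T) (f \<otimes> g)"
    proof (rule tensor_ext[where f = "\<lambda>T. G (p \<otimes> q) T"])
      show "clinear (\<lambda>T. G (p \<otimes> q) T)"
        by (rule clinearI) (simp_all add: G_def tensor_pairing_simps distrib_left sum.distrib sum_distrib_left mult.left_commute)
      show "clinear (\<lambda>T. tensor_pairing ((p \<otimes> q) * T) (f \<otimes> g))"
        by (rule clinear_compose[OF clinear_tensor_pairing clinear_mult(1)])
      show "G (p \<otimes> q) (r \<otimes> s) = tensor_pairing ((p \<otimes> q) * (r \<otimes> s)) (f \<otimes> g)" for r s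
        by (simp add: G_def pure_tensor_mult tensor_pairing_pure pairing_times convolution_def f g sum_pure
            sum_product mult_ac)
    qed
  qed
  finally show ?thesis .
qed

lemma pairing_mult_clinear_ext:
  assumes "\<And>w g. pairing u (S03_word w * g) = tensor_pairing T (S03_word w \<otimes> g)"
  shows "pairing u (f * g) = tensor_pairing T (f \<otimes> g)"
proof (rule S03_clinear_ext[where f = "\<lambda>f. pairing u (f * g)"])
  show "clinear (\<lambda>f. pairing u (f * g))"
    by (rule clinear_compose[OF clinear_pairing clinear_mult(2)])
  show "clinear (\<lambda>f. tensor_pairing T (f \<otimes> g))"
    \<comment> \<open>The outer lift in \<open>tensor_pairing\<close> runs over \<open>T\<close>, so
      linearity in \<open>f\<close> is checked for pure \<open>T\<close> and passed on to
      sums.\<close>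
    by (rule tensor_induct[of "\<lambda>T. clinear (\<lambda>f. tensor_pairing T (f \<otimes> g))"]; rule clinearI)
       (simp_all add: tensor_pairing_simps clinear_add[OF clinear_pairing] clinear_scale[OF clinear_pairing]
          algebra_simps clinear_add[of "\<lambda>f. tensor_pairing _ (f \<otimes> g)"] clinear_scale[of "\<lambda>f. tensor_pairing _ (f \<otimes> g)"])
qed (rule assms)

section \<open>Coproducts of the generators\<close>

lemmas generator_translates = left_translatesD[OF left_translates_A] left_translatesD[OF left_translates_B]
  left_translatesD[OF left_translates_C] left_translatesD[OF left_translates_D]
  left_translatesD[OF left_translates_one] left_translatesD[OF left_translates_E]

text \<open>A concatenation is empty only if both parts are: \<open>s03_E\<close> is the character
  of S03 killing all four generators.\<close>

lemma pairing_E_mult: "pairing s03_E (S03_word w * g) = pairing s03_E (S03_word w) * pairing s03_E g"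
  by (induction w rule: S03_word_induct)
     (simp_all add: mult.assoc generator_translates pairing_simps pairing_E_at_1)

text \<open>Exponents of powers of a add up.\<close>

lemma pairing_A_mult: "pairing s03_A (f * g) = tensor_pairing (s03_A \<otimes> 1 + 1 \<otimes> s03_A) (f \<otimes> g)"
proof (rule pairing_mult_clinear_ext, unfold tensor_pairing_simps)
  show "pairing s03_A (S03_word w * g) =
      pairing s03_A (S03_word w) * pairing 1 g + pairing 1 (S03_word w) * pairing s03_A g" for w g
    by (induction w rule: S03_word_induct)
       (simp_all add: mult.assoc generator_translates pairing_simps pairing_one_mult pairing_one_at_1
          pairing_one_word[of "[x]" for x] pairing_generators_at_1 distrib_right)
qed

text \<open>If b followed by a power of a is cut in two, either the first part contains the b and
  the second is a power of a, or the first part is empty.\<close>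

lemma pairing_B_mult: "pairing s03_B (f * g) = tensor_pairing (s03_B \<otimes> 1 + s03_E \<otimes> s03_B) (f \<otimes> g)"
proof (rule pairing_mult_clinear_ext, unfold tensor_pairing_simps)
  show "pairing s03_B (S03_word w * g) =
      pairing s03_B (S03_word w) * pairing 1 g + pairing s03_E (S03_word w) * pairing s03_B g" for w g
    by (induction w rule: S03_word_induct)
       (simp_all add: mult.assoc generator_translates pairing_simps pairing_one_mult pairing_E_at_1
          pairing_generators_at_1)
qed

text \<open>Here the special letter stands last, so the second part is empty or the first is a power
  of a.\<close>

lemma pairing_C_mult: "pairing s03_C (f * g) = tensor_pairing (s03_C \<otimes> s03_E + 1 \<otimes> s03_C) (f \<otimes> g)"
proof (rule pairing_mult_clinear_ext, unfold tensor_pairing_simps)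
  show "pairing s03_C (S03_word w * g) =
      pairing s03_C (S03_word w) * pairing s03_E g + pairing 1 (S03_word w) * pairing s03_C g" for w g
    by (induction w rule: S03_word_induct)
       (simp_all add: mult.assoc generator_translates pairing_simps pairing_one_at_1 pairing_E_mult
          pairing_generators_at_1)
qed

lemma pairing_D_mult: "pairing s03_D (f * g) = tensor_pairing (s03_D \<otimes> s03_E + s03_E \<otimes> s03_D) (f \<otimes> g)"
proof (rule pairing_mult_clinear_ext, unfold tensor_pairing_simps)
  show "pairing s03_D (S03_word w * g) =
      pairing s03_D (S03_word w) * pairing s03_E g + pairing s03_E (S03_word w) * pairing s03_D g" for w g
    by (induction w rule: S03_word_induct)
       (simp_all add: mult.assoc generator_translates pairing_simps pairing_E_at_1 pairing_E_mult
          pairing_E_word[of "[x]" for x] pairing_generators_at_1)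
qed

section \<open>Existence and uniqueness of the coproduct\<close>

lemma pairing_one_mult_tensor: "pairing 1 (f * g) = tensor_pairing 1 (f \<otimes> g)"
  by (simp add: one_tensor_def tensor_pairing_pure pairing_one_mult)

text \<open>Justifies the definite description in \<open>s03_comult\<close>.\<close>

lemma s03_comult_ex1: "\<exists>!T. \<forall>f g. pairing u (f * g) = tensor_pairing T (f \<otimes> g)"
proof (rule ex_ex1I)
  show "\<exists>T. \<forall>f g. pairing u (f * g) = tensor_pairing T (f \<otimes> g)"
  proof (induction u rule: s03_induct)
    case A show ?case using pairing_A_mult by blast
  next
    case B show ?case using pairing_B_mult by blast
  next
    case C show ?case using pairing_C_mult by blast
  next
    case D show ?case using pairing_D_mult by blast
  next
    case one show ?case using pairing_one_mult_tensor by blast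
  next
    case (add u v)
    then obtain S T where "\<And>f g. pairing u (f * g) = tensor_pairing S (f \<otimes> g)"
      "\<And>f g. pairing v (f * g) = tensor_pairing T (f \<otimes> g)" by blast
    then show ?case by (intro exI[of _ "S + T"]) (simp add: tensor_pairing_simps pairing_simps)
  next
    case (scale c u)
    then obtain S where "\<And>f g. pairing u (f * g) = tensor_pairing S (f \<otimes> g)" by blast
    then show ?case by (intro exI[of _ "c *\<^sub>C S"]) (simp add: tensor_pairing_simps pairing_simps)
  next
    case (mult u v)
    then show ?case using tensor_pairing_mult by blast
  qed
next
  fix S T
  assume "\<forall>f g. pairing u (f * g) = tensor_pairing S (f \<otimes> g)"
    "\<forall>f g. pairing u (f * g) = tensor_pairing T (f \<otimes> g)"
  then have "S - T = 0" by (intro tensor_pairing_nondegenerate) (simp add: tensor_pairing_simps)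
  then show "S = T" by simp
qed

lemma pairing_mult_s03_comult: "pairing u (f * g) = tensor_pairing (s03_comult u) (f \<otimes> g)"
  using theI'[OF s03_comult_ex1[of u]] unfolding s03_comult_def by blast

lemma s03_comult_eqI: "(\<And>f g. pairing u (f * g) = tensor_pairing T (f \<otimes> g)) \<Longrightarrow> s03_comult u = T"
  using s03_comult_ex1[of u] pairing_mult_s03_comult[of u] by blast

lemma s03_comult_generators:
  "s03_comult s03_A = s03_A \<otimes> 1 + 1 \<otimes> s03_A" "s03_comult s03_B = s03_B \<otimes> 1 + s03_E \<otimes> s03_B"
  "s03_comult s03_C = s03_C \<otimes> s03_E + 1 \<otimes> s03_C" "s03_comult s03_D = s03_D \<otimes> s03_E + s03_E \<otimes> s03_D"
  by (rule s03_comult_eqI, rule pairing_A_mult pairing_B_mult pairing_C_mult pairing_D_mult)+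

text \<open>By uniqueness, each law holds once its right-hand side satisfies the duality
  equation.\<close>

lemma algebra_hom_s03_comult: "algebra_hom s03_comult"
  unfolding algebra_hom_def
proof (intro conjI allI)
  show "clinear s03_comult"
    by (rule clinearI; rule s03_comult_eqI)
       (simp_all add: tensor_pairing_simps pairing_simps flip: pairing_mult_s03_comult)
  show "s03_comult 1 = 1" by (rule s03_comult_eqI[OF pairing_one_mult_tensor])
  show "s03_comult (u * v) = s03_comult u * s03_comult v" for u v
    by (rule s03_comult_eqI, rule tensor_pairing_mult; rule pairing_mult_s03_comult)
qed

section \<open>Bialgebra axioms and absence of an antipode\<close>

lemma algebra_hom_s03_counit: "algebra_hom s03_counit"
  unfolding algebra_hom_def s03_counit_def
  by (simp add: clinear_pairing_left pairing_one_at_1 pairing_mult_at_1)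

lemma s03_counit_values:
  "s03_counit s03_A = 0" "s03_counit s03_B = 0" "s03_counit s03_C = 0" "s03_counit s03_D = 0"
  "s03_counit s03_E = 1" "s03_counit 1 = 1"
  by (simp_all add: s03_counit_def pairing_generators_at_1 pairing_E_at_1 pairing_one_at_1)

lemma s03_comult_E: "s03_comult s03_E = s03_E \<otimes> s03_E"
proof (rule s03_comult_eqI)
  show "pairing s03_E (f * g) = tensor_pairing (s03_E \<otimes> s03_E) (f \<otimes> g)" for f g
    by (rule pairing_mult_clinear_ext) (simp add: tensor_pairing_pure pairing_E_mult)
qed

lemma s03_hom_eqI:
  fixes F G :: "s03 \<Rightarrow> 'a::complex_algebra"
  assumes "algebra_hom F" "algebra_hom G"
    and "F s03_A = G s03_A" "F s03_B = G s03_B" "F s03_C = G s03_C" "F s03_D = G s03_D"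
  shows "F u = G u"
  using assms(1,2)
  by (induction u rule: s03_induct)
     (simp_all add: assms(3-) algebra_hom_def clinear_add clinear_scale)

text \<open>Both sides of each axiom are algebra homomorphisms. On generators, coassociativity rests
  on \<open>s03_E\<close> being grouplike, and the counit laws on its counit being 1.\<close>

lemma bialgebra_s03: "bialgebra s03_comult s03_counit"
proof
  note comult_1 = algebra_hom_s03_comult[unfolded algebra_hom_def, THEN conjunct2, THEN conjunct1, unfolded one_tensor_def]
  note lin_comult = algebra_hom_s03_comult[unfolded algebra_hom_def, THEN conjunct1]
    and lin_counit = algebra_hom_s03_counit[unfolded algebra_hom_def, THEN conjunct1]
  show "algebra_hom s03_comult" "algebra_hom s03_counit"
    by (rule algebra_hom_s03_comult algebra_hom_s03_counit)+
  fix x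
  have map_l: "algebra_hom (tensor_map s03_comult (\<lambda>y. y))"
    and map_r: "algebra_hom (tensor_map (\<lambda>y. y) s03_comult)"
    by (intro algebra_hom_tensor_map algebra_hom_s03_comult algebra_hom_ident)+
  show "tensor_assoc (tensor_map s03_comult (\<lambda>y. y) (s03_comult x)) =
      tensor_map (\<lambda>y. y) s03_comult (s03_comult x)"
  proof (rule s03_hom_eqI[where F = "\<lambda>x. tensor_assoc (tensor_map s03_comult (\<lambda>y. y) (s03_comult x))"])
    show "algebra_hom (\<lambda>x. tensor_assoc (tensor_map s03_comult (\<lambda>y. y) (s03_comult x)))"
      by (rule algebra_hom_compose[OF algebra_hom_tensor_assoc algebra_hom_compose[OF map_l algebra_hom_s03_comult]])
    show "algebra_hom (\<lambda>x. tensor_map (\<lambda>y. y) s03_comult (s03_comult x))"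
      by (rule algebra_hom_compose[OF map_r algebra_hom_s03_comult])
  qed (simp_all add: s03_comult_generators s03_comult_E comult_1 pure_tensor_simps(1,3) tensor_assoc_pure
      clinear_tensor_map[OF lin_comult clinear_ident, THEN clinear_add]
      clinear_tensor_map[OF clinear_ident lin_comult, THEN clinear_add] clinear_add[OF clinear_tensor_assoc]
      tensor_map_pure[OF lin_comult clinear_ident] tensor_map_pure[OF clinear_ident lin_comult] add.assoc)
  show "tensor_lift (\<lambda>y z. s03_counit y *\<^sub>C z) (s03_comult x) = x"
  proof (rule s03_hom_eqI[where F = "\<lambda>x. tensor_lift (\<lambda>y z. s03_counit y *\<^sub>C z) (s03_comult x)"])
    note bil = cbilinear_scaled(1)[OF lin_counit]
    show "algebra_hom (\<lambda>x. tensor_lift (\<lambda>y z. s03_counit y *\<^sub>C z) (s03_comult x))"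
      using algebra_hom_s03_counit unfolding algebra_hom_def
      by (intro algebra_hom_compose[OF algebra_hom_tensor_lift[OF bil] algebra_hom_s03_comult, unfolded algebra_hom_def])
         (simp_all add: scaleC_one mult_scaleC_left mult_scaleC_right scaleC_scaleC)
  qed (simp_all add: algebra_hom_ident s03_comult_generators clinear_add[OF clinear_tensor_lift[OF cbilinear_scaled(1)[OF lin_counit]]]
      tensor_lift_pure[OF cbilinear_scaled(1)[OF lin_counit]] s03_counit_values scaleC_one)
  show "tensor_lift (\<lambda>y z. s03_counit z *\<^sub>C y) (s03_comult x) = x"
  proof (rule s03_hom_eqI[where F = "\<lambda>x. tensor_lift (\<lambda>y z. s03_counit z *\<^sub>C y) (s03_comult x)"])
    note bil = cbilinear_scaled(2)[OF lin_counit]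
    show "algebra_hom (\<lambda>x. tensor_lift (\<lambda>y z. s03_counit z *\<^sub>C y) (s03_comult x))"
      using algebra_hom_s03_counit unfolding algebra_hom_def
      by (intro algebra_hom_compose[OF algebra_hom_tensor_lift[OF bil] algebra_hom_s03_comult, unfolded algebra_hom_def])
         (simp_all add: scaleC_one mult_scaleC_left mult_scaleC_right scaleC_scaleC)
  qed (simp_all add: algebra_hom_ident s03_comult_generators clinear_add[OF clinear_tensor_lift[OF cbilinear_scaled(2)[OF lin_counit]]]
      tensor_lift_pure[OF cbilinear_scaled(2)[OF lin_counit]] s03_counit_values scaleC_one)
qed

text \<open>\<open>s03_E\<close> is grouplike, so an antipode would invert it, but it annihilates \<open>s03_B\<close>.\<close>

lemma no_antipode_s03: "\<not> antipode s03_comult s03_counit S"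
proof
  assume S: "antipode s03_comult s03_counit S"
  then have "cbilinear (\<lambda>y z. S y * z)"
    unfolding antipode_def by (intro cbilinear_compose[OF cbilinear_mult _ clinear_ident]) simp
  \<comment> \<open>The left antipode law at the grouplike \<open>s03_E\<close>.\<close>
  from tensor_lift_pure[OF this, of s03_E s03_E] S have "S s03_E * s03_E = 1"
    unfolding antipode_def by (metis s03_comult_E s03_counit_def pairing_E_at_1 scaleC_one)
  then have "s03_B = S s03_E * (s03_E * s03_B)" by (simp flip: mult.assoc)
  then have "pairing s03_B \<b> = 0" by (simp add: E_mult_generators pairing_zero)
  moreover have "\<exists>k. [Gen_b] = Gen_b # replicate k Gen_a" by (rule exI[of _ 0]) simp
  ultimately show False by (simp add: pairing_B_word)
qed

theorem proposition1:
  shows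
    "(\<forall>u. \<exists>!T. \<forall>f g. pairing u (f * g) = tensor_pairing T (f \<otimes> g)) \<and>
     bialgebra s03_comult s03_counit \<and>

     commutator s03_A s03_B = 0 \<and> commutator s03_A s03_C = 0 \<and>
     s03_A * s03_D = s03_D \<and> s03_D * s03_A = s03_D \<and> s03_D ^ 3 = s03_D \<and>
     s03_B ^ 2 * s03_D = s03_D \<and> s03_D * s03_B ^ 2 = s03_D \<and>
     commutator s03_B s03_C = (-2) *\<^sub>C s03_D \<and>
     s03_D * s03_B = - (s03_B * s03_D) \<and> s03_D * s03_B = s03_C * s03_D ^ 2 \<and>
     s03_D * s03_B = s03_D ^ 2 * s03_C \<and>
     s03_C * s03_D + s03_D * s03_C = 0 \<and> s03_B ^ 2 + s03_C ^ 2 = 0 \<and>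
     s03_B ^ 3 = s03_B \<and> s03_C ^ 3 = - s03_C \<and> s03_B ^ 2 * s03_A = s03_A \<and>

     s03_comult s03_A = s03_A \<otimes> 1 + 1 \<otimes> s03_A \<and>
     s03_comult s03_B = s03_B \<otimes> 1 + (1 - s03_B ^ 2) \<otimes> s03_B \<and>
     s03_comult s03_C = s03_C \<otimes> (1 - s03_B ^ 2) + 1 \<otimes> s03_C \<and>
     s03_comult s03_D = s03_D \<otimes> (1 - s03_B ^ 2) + (1 - s03_B ^ 2) \<otimes> s03_D \<and>

     s03_counit s03_A = 0 \<and> s03_counit s03_B = 0 \<and>
     s03_counit s03_C = 0 \<and> s03_counit s03_D = 0 \<and>

     s03_A \<in> center \<and> s03_B ^ 2 \<in> center \<and> s03_B ^ 2 = - (s03_C ^ 2) \<and> s03_D ^ 2 \<in> center \<and>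

     \<not> (\<exists>S. antipode s03_comult s03_counit S)"
proof -
  have C_square: "s03_C ^ 2 = - (s03_B ^ 2)"
    using B_square_plus_C_square by (simp add: eq_neg_iff_add_eq_0 add.commute)
  have B_cube: "s03_B ^ 3 = s03_B"
    using B_square_mult(2) by (simp add: power3_eq_cube power2_eq_square)
  \<comment> \<open>The sign comes from \<open>s03_C ^ 2 = - (s03_B ^ 2)\<close>, since
    \<open>s03_B ^ 2\<close> acts as identity on \<open>s03_C\<close>.\<close>
  have "s03_C ^ 3 = s03_C ^ 2 * s03_C" by (simp add: power3_eq_cube power2_eq_square)
  then have C_cube: "s03_C ^ 3 = - s03_C" by (simp add: C_square B_square_mult(3))
  have commutators: "commutator s03_A s03_B = 0" "commutator s03_A s03_C = 0"
    by (simp_all add: A_B_commute A_C_commute)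
  have B_square_eq: "s03_B ^ 2 = - (s03_C ^ 2)" by (simp add: C_square)
  have no_antipode: "\<not> (\<exists>S. antipode s03_comult s03_counit S)"
    using no_antipode_s03 by blast
  show ?thesis
    by (intro conjI allI s03_comult_ex1 bialgebra_s03 commutators A_mult_D D_mult_A D_cube B_square_mult
        B_C_commutator D_mult_B C_D_anticommute B_square_plus_C_square B_cube C_cube
        s03_comult_generators[unfolded s03_E_def] s03_counit_values A_central B_square_central
        B_square_eq D_square_central no_antipode)
qed

end
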